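(* Let $\gamma$ be a Borel probability measure on $\mathbb{R}$, let $X_1,X_2,\dots$ be i.i.d. real random variables with law $\gamma$ on a probability space $(\Omega,\mathcal{F},\mathbb{P})$, and let $\Lambda(t)=\log\mathbb{E}[e^{tX_1}]$, $t\in\mathbb{R}$. Assume that $$\int_{\mathbb{R}}|\Lambda(tu)|^4\,\nu(du)<\infty\quad\text{for all } t\in\mathbb{R},$$ where $\nu$ is the standard Gaussian measure on $\mathbb{R}$. Let $\sigma$ be a Borel probability measure on $\mathbb{S}=\prod_{n\in\mathbb{N}}\mathbb{S}^{n-1}$ such that $\sigma\circ\pi_n^{-1}=\sigma_{n-1}$ for every $n\in\mathbb{N}$. Then for $\sigma$-almost every $\theta=(\theta^{(1)},\theta^{(2)},\dots)\in\mathbb{S}$, the sequence of random variables $$W_\theta^{(n)}=\frac{1}{\sqrt n}\sum_{i=1}^n X_i\,\theta^{(n)}_i,\qquad n\in\mathbb{N},$$ satisfies a large deviation principle with the convex good rate function $\mathbb{I}_\sigma:\mathbb{R}\to[0,\infty]$ given by $$\mathbb{I}_\sigma(w)=\Psi^*(w)=\sup_{t\in\mathbb{R}}\{tw-\Psi(t)\},\qquad \Psi(t)=\int_{\mathbb{R}}\Lambda(tu)\tfrac{1}{\sqrt{2\pi}}e^{-u^2/2}\,du.$$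
   Context: $\mathbb{S}^{n-1}$ is the Euclidean unit sphere in $\mathbb{R}^n$, and $\sigma_{n-1}$ is the unique rotation invariant probability measure on $\mathbb{S}^{n-1}$. $\pi_n:\mathbb{S}\to\mathbb{S}^{n-1}$ is the coordinate map $\pi_n(\theta)=\theta^{(n)}$; $\theta^{(n)}_i$ is the $i$-th coordinate of $\theta^{(n)}\in\mathbb{R}^n$. For fixed $\theta$, the randomness of $W_\theta^{(n)}$ comes only from $(X_i)$, under $\mathbb{P}$. Large deviation principle (LDP): a sequence $(\mu_n)_{n\in\mathbb{N}}$ of Borel probability measures on $\mathbb{R}$ satisfies an LDP with rate function $\mathbb{I}:\mathbb{R}\to[0,\infty]$ if $\mathbb{I}$ is lower semicontinuous and for all Borel $\Gamma\subset\mathbb{R}$, $$-\inf_{x\in\Gamma^\circ}\mathbb{I}(x)\le\liminf_{n\to\infty}\tfrac1n\log\mu_n(\Gamma^\circ)\le\limsup_{n\to\infty}\tfrac1n\log\mu_n(\bar\Gamma)\le-\inf_{x\in\bar\Gamma}\mathbb{I}(x),$$ where $\Gamma^\circ$ and $\bar\Gamma$ are the interior and closure of $\Gamma$. The rate function is good if it has compact level sets $\{x:\mathbb{I}(x)\le c\}$, $c<\infty$. A sequence of real random variables satisfies an LDP if the sequence of their laws under $\mathbb{P}$ does. *)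

theory Defs
  imports "HOL-Probability.Probability"
begin

text \<open>
  The logarithm on \<open>[0, \<infinity>]\<close>, with \<open>log 0 = -\<infinity>\<close> and \<open>log \<infinity> = \<infinity>\<close>.
\<close>

definition log_ennreal :: "ennreal \<Rightarrow> ereal" where
  "log_ennreal x =
    (if x = 0 then -\<infinity> else if x = \<top> then \<infinity> else ereal (ln (enn2real x)))"


section \<open>Large deviation principles on the real line\<close>

definition rate_function :: "(real \<Rightarrow> ereal) \<Rightarrow> bool" where
  "rate_function I \<longleftrightarrow>
    (\<forall>x. 0 \<le> I x) \<and> (\<forall>x. I x \<le> Liminf (at x) I)"

definition good_rate_function :: "(real \<Rightarrow> ereal) \<Rightarrow> bool" where
  "good_rate_function I \<longleftrightarrow>
    rate_function I \<and> (\<forall>c::real. compact {x. I x \<le> ereal c})"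

text \<open>
  The library's \<open>convex_on\<close> only covers real-valued functions.  For the nonnegative
  functions considered here, no sum \<open>\<infinity> - \<infinity>\<close> occurs, and \<open>0 * \<infinity> = 0\<close> in \<^typ>\<open>ereal\<close>.
\<close>

definition convex_ereal :: "(real \<Rightarrow> ereal) \<Rightarrow> bool" where
  "convex_ereal I \<longleftrightarrow>
    (\<forall>x y u v. 0 \<le> u \<longrightarrow> 0 \<le> v \<longrightarrow> u + v = 1 \<longrightarrow>
      I (u * x + v * y) \<le> ereal u * I x + ereal v * I y)"

text \<open>
  Sequences are indexed by \<open>n \<ge> 1\<close>; the value at \<open>0\<close> is irrelevant.
\<close>

definition satisfies_LDP :: "(nat \<Rightarrow> real measure) \<Rightarrow> (real \<Rightarrow> ereal) \<Rightarrow> bool" where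
  "satisfies_LDP \<mu> I \<longleftrightarrow>
    (\<forall>n\<ge>1. prob_space (\<mu> n) \<and> sets (\<mu> n) = sets borel) \<and>
    rate_function I \<and>
    (\<forall>\<Gamma>\<in>sets borel.
      - (INF x\<in>interior \<Gamma>. I x)
        \<le> liminf (\<lambda>n. ereal (1 / real n) * log_ennreal (emeasure (\<mu> n) (interior \<Gamma>))) \<and>
      liminf (\<lambda>n. ereal (1 / real n) * log_ennreal (emeasure (\<mu> n) (interior \<Gamma>)))
        \<le> limsup (\<lambda>n. ereal (1 / real n) * log_ennreal (emeasure (\<mu> n) (closure \<Gamma>))) \<and>
      limsup (\<lambda>n. ereal (1 / real n) * log_ennreal (emeasure (\<mu> n) (closure \<Gamma>)))
        \<le> - (INF x\<in>closure \<Gamma>. I x))"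


section \<open>Spheres of varying dimension\<close>

text \<open>
  A vector of \<open>\<real>\<^sup>n\<close> is a function in \<open>{1..n} \<rightarrow>\<^sub>E UNIV\<close>, and the Borel sets of \<open>\<real>\<^sup>n\<close> are
  those of the product measurable space \<open>\<Pi>\<^sub>M i\<in>{1..n}. borel\<close>.  All spaces below have
  countable bases, so the Borel sets of a product are the product measurable sets and the
  Borel sets of a subspace are the traces.
\<close>

definition unit_sphere :: "nat \<Rightarrow> (nat \<Rightarrow> real) set" where
  "unit_sphere n = {x \<in> {1..n} \<rightarrow>\<^sub>E UNIV. sqrt (\<Sum>i=1..n. (x i)\<^sup>2) = 1}"

definition sphere_borel :: "nat \<Rightarrow> (nat \<Rightarrow> real) measure" where
  "sphere_borel n = restrict_space (\<Pi>\<^sub>M i\<in>{1..n}. borel) (unit_sphere n)"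

text \<open>
  An orthogonal \<open>n \<times> n\<close> matrix has its entries at indices in \<open>{1..n}\<close>; others are ignored.
\<close>

definition orthogonal_mat :: "nat \<Rightarrow> (nat \<Rightarrow> nat \<Rightarrow> real) \<Rightarrow> bool" where
  "orthogonal_mat n A \<longleftrightarrow>
    (\<forall>i\<in>{1..n}. \<forall>j\<in>{1..n}. (\<Sum>k=1..n. A k i * A k j) = (if i = j then 1 else 0))"

definition mat_apply :: "nat \<Rightarrow> (nat \<Rightarrow> nat \<Rightarrow> real) \<Rightarrow> (nat \<Rightarrow> real) \<Rightarrow> nat \<Rightarrow> real" where
  "mat_apply n A x = (\<lambda>i\<in>{1..n}. \<Sum>j=1..n. A i j * x j)"

text \<open>
  Exactly one measure has this property for each \<open>n \<ge> 1\<close>, namely \<open>\<sigma>\<^bsub>n-1\<^esub>\<close>.  Invariance is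
  under all of \<open>O(n)\<close>: for \<open>n = 1\<close> the group \<open>SO(1)\<close> is trivial and would not determine the
  measure on the two-point sphere.
\<close>

definition rotation_invariant_prob :: "nat \<Rightarrow> (nat \<Rightarrow> real) measure \<Rightarrow> bool" where
  "rotation_invariant_prob n M \<longleftrightarrow>
    prob_space M \<and> sets M = sets (sphere_borel n) \<and>
    (\<forall>A. orthogonal_mat n A \<longrightarrow> distr M (sphere_borel n) (mat_apply n A) = M)"

definition sphere_sequences :: "(nat \<Rightarrow> nat \<Rightarrow> real) measure" where
  "sphere_sequences = (\<Pi>\<^sub>M n\<in>{1..}. sphere_borel n)"


section \<open>Random projections\<close>

definition std_gaussian :: "real measure" where
  "std_gaussian = density lborel (\<lambda>u. ennreal (std_normal_density u))"

definition log_mgf :: "'a measure \<Rightarrow> ('a \<Rightarrow> real) \<Rightarrow> real \<Rightarrow> ereal" where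
  "log_mgf M Y t = log_ennreal (\<integral>\<^sup>+ \<omega>. ennreal (exp (t * Y \<omega>)) \<partial>M)"

text \<open>
  \<open>L\<close> is \<open>[-\<infinity>, \<infinity>]\<close>-valued, and \<^const>\<open>real_of_ereal\<close> sends \<open>\<plusminus>\<infinity>\<close> to \<open>0\<close>.  A logarithmic
  moment generating function with finite fourth Gaussian moment at every scale is finite
  almost everywhere, hence everywhere by convexity, and the integrand is then integrable.
\<close>

definition gaussian_average :: "(real \<Rightarrow> ereal) \<Rightarrow> real \<Rightarrow> real" where
  "gaussian_average L t =
    (LINT u|lborel. real_of_ereal (L (t * u)) * (1 / sqrt (2 * pi) * exp (- u\<^sup>2 / 2)))"

definition legendre_transform :: "(real \<Rightarrow> real) \<Rightarrow> real \<Rightarrow> ereal" where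
  "legendre_transform \<Psi> w = (SUP t. ereal (t * w - \<Psi> t))"

definition weighted_sum ::
    "(nat \<Rightarrow> 'a \<Rightarrow> real) \<Rightarrow> (nat \<Rightarrow> nat \<Rightarrow> real) \<Rightarrow> nat \<Rightarrow> 'a \<Rightarrow> real" where
  "weighted_sum X \<theta> n \<omega> = 1 / sqrt (real n) * (\<Sum>i=1..n. X i \<omega> * \<theta> n i)"

end

theory Submission
  imports Defs
begin

text \<open>
  Let \<open>\<Lambda>\<close> be the logarithmic moment generating function of \<open>X 1\<close> and \<open>\<Psi>\<close> its Gaussian average.  By
  independence, \<open>E exp (n t W)\<close> for the \<open>n\<close>-th weighted sum \<open>W\<close> is \<open>exp (n * L n t)\<close> with
  \<open>L n t = 1 / n * (\<Sum>i=1..n. \<Lambda> (t * sqrt n * \<theta> n i))\<close> (\<open>weighted_sum_mgf\<close>).  In high dimension the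
  coordinates of \<open>sqrt n * \<theta> n\<close> behave like independent standard Gaussian variables, so \<open>L n t\<close> should
  converge to \<open>\<Psi> t\<close>.  Once it does for all \<open>t\<close>, the large deviation principle is the Gaertner-Ellis
  theorem (\<open>gaertner_ellis\<close>), since \<open>\<Psi>\<close> is finite and differentiable on the whole line.  The work
  consists in the convergence, in the differentiability, and in the Gaertner-Ellis theorem itself.

  \<^bold>\<open>Convergence.\<close>  Points on spheres of different dimension may depend on each other in any way, so
  almost sure convergence comes from the Borel-Cantelli lemma, and one needs a summable bound on the
  probability that \<open>L n t\<close> is far from \<open>\<Psi> t\<close>.  For a Gaussian vector \<open>g\<close> in place of \<open>sqrt n * \<theta> n\<close>,
  Markov's inequality for the fourth power gives \<open>C / n\<^sup>2\<close> (\<open>empirical_deviation_bound\<close>); here the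
  fourth moment condition enters.  The normalized vector \<open>sqrt n * g / \<bar>g\<bar>\<close> differs from \<open>g\<close> by a factor
  close to one.  As \<open>1 / n * (\<Sum>i. \<Lambda> (t * g i))\<close> is convex in \<open>t\<close>, its closeness to \<open>\<Psi>\<close> at three points
  implies closeness on an interval (\<open>convex_three_point_bound\<close>), so this factor does no harm
  (\<open>gaussian_normalized_deviation\<close>).  The same convexity extends the almost sure convergence from
  rational \<open>t\<close> to all \<open>t\<close>.

  \<^bold>\<open>From the Gaussian vector to the sphere.\<close>  A rotation invariant probability measure \<open>M\<close> on the sphere
  satisfies \<open>M B \<le> N B'\<close>, where \<open>N\<close> is the law of \<open>g\<close> and \<open>B'\<close> contains all vectors whose direction is
  close to \<open>B\<close> (\<open>sphere_measure_le_gaussian\<close>).  One integrates the indicator of a small angle between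
  \<open>\<theta>\<close> and \<open>g\<close> over \<open>\<theta>\<close> and \<open>g\<close> in both orders.  The inner integrals are constant: in \<open>g\<close> because
  Householder reflections act transitively on the sphere, and in \<open>\<theta>\<close> because the joint law of the
  inner product of \<open>\<theta>\<close> and \<open>g\<close> and of the norm of \<open>g\<close> depends on the norm of \<open>\<theta>\<close> only
  (\<open>gaussian_projection_norm_law\<close>), by induction on the dimension and a rotation in a plane.

  \<^bold>\<open>Differentiability.\<close>  Both the moment generating function and \<open>\<Psi>\<close> are integrals of convex
  differentiable functions of \<open>t\<close>.  The difference quotients of a convex function are monotone, hence
  dominated, and one may differentiate under the integral (\<open>convex_family_integral_derivative\<close>).

  \<^bold>\<open>Gaertner-Ellis.\<close>  The upper bound is Chernoff's inequality on both sides of \<open>\<Psi>' 0\<close>.  The lower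
  bound at \<open>\<Psi>' t\<close> follows by tilting the measures with \<open>exp (n * t * x)\<close>.  The remaining points of finite
  rate are limits of points \<open>\<Psi>' t\<close> with rates that are no larger (\<open>slope_attained\<close>, \<open>lower_bound\<close>).
\<close>

section \<open>Convex functions on the line\<close>

lemma convex_on_scaled_argument:
  fixes H :: "real \<Rightarrow> real"
  assumes "convex_on UNIV H"
  shows "convex_on UNIV (\<lambda>t. H (t * u))"
proof (rule convex_onI)
  fix t x y :: real assume t: "0 < t" "t < 1"
  have "((1 - t) *\<^sub>R x + t *\<^sub>R y) * u = (1 - t) *\<^sub>R (x * u) + t *\<^sub>R (y * u)" by (simp add: algebra_simps)
  then show "H (((1 - t) *\<^sub>R x + t *\<^sub>R y) * u) \<le> (1 - t) * H (x * u) + t * H (y * u)"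
    using convex_onD[OF assms, of t "x * u" "y * u"] t by simp
qed simp

lemma convex_on_average:
  fixes H :: "real \<Rightarrow> real"
  assumes "convex_on UNIV H"
  shows "convex_on UNIV (\<lambda>t. 1 / real n * (\<Sum>i=1..n. H (t * x i)))"
proof (rule convex_on_cmul)
  have "finite J \<Longrightarrow> convex_on UNIV (\<lambda>t. \<Sum>i\<in>J. H (t * x i))" for J
    by (induction J rule: finite_induct)
       (auto simp: convex_on_const intro!: convex_on_add convex_on_scaled_argument assms)
  then show "convex_on UNIV (\<lambda>t. \<Sum>i=1..n. H (t * x i))" by simp
qed simp

text \<open>
  The upper bound is convexity between \<open>p - d\<close> and \<open>p + d\<close>.  For the lower bound, \<open>p\<close> is the
  midpoint of \<open>y\<close> and its mirror image \<open>2 * p - y\<close>, so \<open>G y \<ge> 2 * G p - G (2 * p - y)\<close>, and the upper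
  bound applies to the mirror image.  Hence control of a convex function at three points controls it
  on a whole interval, which serves twice below: to absorb a random rescaling of the argument and to
  pass from rational to real arguments.
\<close>

lemma convex_three_point_bound:
  fixes G :: "real \<Rightarrow> real"
  assumes G: "convex_on UNIV G"
    and e: "\<bar>G (p - d) - a\<bar> \<le> e" "\<bar>G p - a\<bar> \<le> e" "\<bar>G (p + d) - a\<bar> \<le> e"
    and y: "\<bar>y - p\<bar> \<le> d"
  shows "\<bar>G y - a\<bar> \<le> 3 * e"
proof (cases "d = 0")
  case True
  then show ?thesis using e y by auto
next
  case False
  with y have d: "d > 0" by auto
  have upper: "G z \<le> a + e" if z: "\<bar>z - p\<bar> \<le> d" for z
  proof -
    define u where "u = (z - p + d) / (2 * d)"
    have u: "0 \<le> u" "u \<le> 1" using z d by (auto simp: u_def field_simps)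
    have "z = (1 - u) *\<^sub>R (p - d) + u *\<^sub>R (p + d)"
      using d by (simp add: u_def field_simps)
    then have "G z \<le> (1 - u) * G (p - d) + u * G (p + d)"
      using convex_onD[OF G u] by simp
    also have "\<dots> \<le> (1 - u) * (a + e) + u * (a + e)"
      using e u by (intro add_mono mult_left_mono) auto
    finally show ?thesis by (simp add: algebra_simps)
  qed
  have "p = (1 - 1/2) *\<^sub>R y + (1/2) *\<^sub>R (2 * p - y)" by (simp add: field_simps)
  then have "G p \<le> (1 - 1/2) * G y + (1/2) * G (2 * p - y)"
    using convex_onD[OF G, of "1/2" y "2 * p - y"] by simp
  moreover have "G (2 * p - y) \<le> a + e" using y by (intro upper) auto
  moreover have "G y \<le> a + e" using y by (intro upper)
  ultimately show ?thesis using e by (auto simp: abs_le_iff)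
qed

text \<open>
  Choose a rational point near \<open>t\<close> and a rational step such that \<open>t\<close> lies within the step of the
  point, and apply the three-point bound.
\<close>

lemma convex_tendsto_from_rationals:
  fixes G :: "nat \<Rightarrow> real \<Rightarrow> real"
  assumes convex: "\<And>n. convex_on UNIV (G n)"
    and cont: "isCont H t"
    and lim: "\<And>q. q \<in> \<rat> \<Longrightarrow> (\<lambda>n. G n q) \<longlonglongrightarrow> H q"
  shows "(\<lambda>n. G n t) \<longlonglongrightarrow> H t"
proof (rule LIMSEQ_I)
  fix r :: real assume r: "0 < r"
  from cont r obtain d where d: "d > 0" "\<And>x. \<bar>x - t\<bar> < d \<Longrightarrow> \<bar>H x - H t\<bar> < r / 8"
    unfolding isCont_def LIM_eq
    by (metis abs_0 cancel_comm_monoid_add_class.diff_cancel divide_pos_pos real_norm_def zero_less_numeral)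
  from Rats_dense_in_real[of "d/4" "d/3"] d obtain k where k: "k \<in> \<rat>" "d/4 < k" "k < d/3" by auto
  from Rats_dense_in_real[of "t" "t + d/4"] d obtain p where p: "p \<in> \<rat>" "t < p" "p < t + d/4" by auto
  have ev: "eventually (\<lambda>n. \<bar>G n q - H t\<bar> \<le> r / 4) sequentially"
    if q: "q \<in> \<rat>" "\<bar>q - t\<bar> < d" for q
  proof -
    from lim[OF q(1)] have "eventually (\<lambda>n. \<bar>G n q - H q\<bar> < r / 8) sequentially"
      using r unfolding tendsto_iff dist_real_def
      by (metis zero_less_divide_iff zero_less_numeral)
    then show ?thesis
      by eventually_elim (use d(2)[OF q(2)] in linarith)
  qed
  have "eventually (\<lambda>n. \<bar>G n (p - k) - H t\<bar> \<le> r / 4 \<and> \<bar>G n p - H t\<bar> \<le> r / 4 \<and>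
      \<bar>G n (p + k) - H t\<bar> \<le> r / 4) sequentially"
    using k p by (intro eventually_conj ev) (auto intro: Rats_add Rats_diff)
  then have "eventually (\<lambda>n. \<bar>G n t - H t\<bar> \<le> 3 * (r / 4)) sequentially"
    by eventually_elim (rule convex_three_point_bound[OF convex, of _ p k], use p k in auto)
  then have "eventually (\<lambda>n. norm (G n t - H t) < r) sequentially"
    by eventually_elim (use r in auto)
  then show "\<exists>no. \<forall>n\<ge>no. norm (G n t - H t) < r"
    by (simp add: eventually_sequentially)
qed

text \<open>
  The slopes of a convex function increase, so the slope of every chord at \<open>t\<close> of length at most
  one lies between those over \<open>[t - 1, t]\<close> and \<open>[t, t + 1]\<close>.
\<close>

lemma convex_difference_quotient_bound:
  fixes f :: "real \<Rightarrow> real"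
  assumes f: "convex_on UNIV f" and h: "h \<noteq> 0" "\<bar>h\<bar> \<le> 1"
  shows "\<bar>(f (t + h) - f t) / h\<bar> \<le> \<bar>f (t + 1) - f t\<bar> + \<bar>f t - f (t - 1)\<bar>"
proof -
  note D = convex_onD[OF f _ _ UNIV_I UNIV_I]
  show ?thesis
  proof (cases "h > 0")
    case True
    have "f (t + h) \<le> (1 - h) * f t + h * f (t + 1)"
      using D[of h t "t + 1"] h True by (simp add: algebra_simps)
    then have 1: "(f (t + h) - f t) / h \<le> f (t + 1) - f t"
      using True by (simp add: field_simps)
    have e: "(1 - h/(1+h)) *\<^sub>R (t + h) + (h/(1+h)) *\<^sub>R (t - 1) = t"
      using True by (simp add: divide_simps) (simp add: algebra_simps)
    have "f t \<le> (1 - h/(1+h)) * f (t + h) + h/(1+h) * f (t - 1)"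
      using D[of "h/(1+h)" "t + h" "t - 1"] True unfolding e by simp
    then have "(1 + h) * f t \<le> f (t + h) + h * f (t - 1)"
      using True by (simp add: divide_simps mult.commute split: if_splits)
    then have 2: "f t - f (t - 1) \<le> (f (t + h) - f t) / h"
      using True by (simp add: field_simps)
    from 1 2 show ?thesis by linarith
  next
    case False
    define k where "k = - h"
    have k: "0 < k" "k \<le> 1" "h = - k" using False h by (auto simp: k_def)
    have "f (t - k) \<le> (1 - k) * f t + k * f (t - 1)"
      using D[of k t "t - 1"] k by (simp add: algebra_simps)
    then have 1: "f t - f (t - 1) \<le> (f t - f (t - k)) / k"
      using k by (simp add: field_simps)
    have e: "(1 - k/(1+k)) *\<^sub>R (t - k) + (k/(1+k)) *\<^sub>R (t + 1) = t"
      using k by (simp add: divide_simps) (simp add: algebra_simps)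
    have "f t \<le> (1 - k/(1+k)) * f (t - k) + k/(1+k) * f (t + 1)"
      using D[of "k/(1+k)" "t - k" "t + 1"] k unfolding e by simp
    then have "(1 + k) * f t \<le> f (t - k) + k * f (t + 1)"
      using k by (simp add: divide_simps mult.commute split: if_splits)
    then have 2: "(f t - f (t - k)) / k \<le> f (t + 1) - f t"
      using k by (simp add: field_simps)
    have "(f (t + h) - f t) / h = (f t - f (t - k)) / k"
      using k by (simp add: divide_simps)
    with 1 2 show ?thesis by linarith
  qed
qed

text \<open>
  Convexity dominates all difference quotients with \<open>\<bar>h\<bar> \<le> 1\<close> by one integrable function, so
  dominated convergence permits differentiation under the integral sign.  The lemma is used for
  \<open>exp (t * Y \<omega>)\<close>, which gives a differentiable logarithmic moment generating function \<open>\<Lambda>\<close>, and then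
  for \<open>\<Lambda> (t * u)\<close> under the Gaussian measure.
\<close>

lemma convex_family_integral_derivative:
  fixes f f' :: "real \<Rightarrow> 'a \<Rightarrow> real"
  assumes convex: "\<And>x. x \<in> space M \<Longrightarrow> convex_on UNIV (\<lambda>t. f t x)"
    and deriv: "\<And>x t. x \<in> space M \<Longrightarrow> ((\<lambda>t. f t x) has_real_derivative f' t x) (at t)"
    and int: "\<And>t. integrable M (f t)"
  shows "((\<lambda>t. \<integral>x. f t x \<partial>M) has_real_derivative (\<integral>x. f' t x \<partial>M)) (at t)"
  unfolding DERIV_def tendsto_at_iff_sequentially
proof (intro allI impI)
  fix h :: "nat \<Rightarrow> real" assume h: "\<forall>i. h i \<in> UNIV - {0}" "h \<longlonglongrightarrow> 0"
  from h(2) have "eventually (\<lambda>i. \<bar>h i\<bar> < 1) sequentially"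
    by (auto simp: tendsto_iff dist_real_def)
  then obtain N where N: "\<And>i. \<bar>h (i + N)\<bar> < 1"
    unfolding eventually_sequentially by (meson le_add2)
  define k where "k i = h (i + N)" for i
  have k: "k i \<noteq> 0" "\<bar>k i\<bar> \<le> 1" for i using h(1) N[of i] by (auto simp: k_def)
  have k0: "k \<longlonglongrightarrow> 0" unfolding k_def using h(2) by (rule LIMSEQ_ignore_initial_segment)
  have lim: "(\<lambda>i. (f (t + k i) x - f t x) / k i) \<longlonglongrightarrow> f' t x" if x: "x \<in> space M" for x
    using deriv[OF x, of t] k k0 unfolding DERIV_def tendsto_at_iff_sequentially
    by (auto simp: o_def)
  have q: "integrable M (\<lambda>x. (f (t + k i) x - f t x) / k i)" for i
    using int by auto
  have "(\<lambda>i. \<integral>x. (f (t + k i) x - f t x) / k i \<partial>M) \<longlonglongrightarrow> (\<integral>x. f' t x \<partial>M)"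
  proof (rule integral_dominated_convergence)
    show "f' t \<in> borel_measurable M"
      by (rule borel_measurable_LIMSEQ_real[OF lim borel_measurable_integrable[OF q]])
    show "integrable M (\<lambda>x. \<bar>f (t + 1) x - f t x\<bar> + \<bar>f t x - f (t - 1) x\<bar>)"
      using int by auto
    show "AE x in M. norm ((f (t + k i) x - f t x) / k i)
        \<le> \<bar>f (t + 1) x - f t x\<bar> + \<bar>f t x - f (t - 1) x\<bar>" for i
    proof (rule AE_I2)
      fix x assume "x \<in> space M"
      from convex_difference_quotient_bound[OF convex[OF this] k, of t i]
      show "norm ((f (t + k i) x - f t x) / k i)
          \<le> \<bar>f (t + 1) x - f t x\<bar> + \<bar>f t x - f (t - 1) x\<bar>"
        unfolding real_norm_def .
    qed
  qed (use lim q in auto)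
  moreover have "(\<integral>x. (f (t + k i) x - f t x) / k i \<partial>M)
      = ((\<integral>x. f (t + k i) x \<partial>M) - (\<integral>x. f t x \<partial>M)) / k i" for i
    using int k(1)[of i] by simp
  ultimately have "(\<lambda>i. ((\<integral>x. f (t + k i) x \<partial>M) - (\<integral>x. f t x \<partial>M)) / k i)
      \<longlonglongrightarrow> (\<integral>x. f' t x \<partial>M)" by (simp only:)
  then show "((\<lambda>h. ((\<integral>x. f (t + h) x \<partial>M) - (\<integral>x. f t x \<partial>M)) / h) \<circ> h)
      \<longlonglongrightarrow> (\<integral>x. f' t x \<partial>M)"
    unfolding k_def o_def by (rule LIMSEQ_offset)
qed

section \<open>The Legendre transform as a rate function\<close>

lemma legendre_upper: "ereal (t * w - \<Psi> t) \<le> legendre_transform \<Psi> w"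
  unfolding legendre_transform_def by (rule SUP_upper) simp

lemma legendre_nonneg: "\<Psi> 0 = 0 \<Longrightarrow> 0 \<le> legendre_transform \<Psi> w"
  using legendre_upper[of 0 w \<Psi>] by (simp add: zero_ereal_def)

lemma legendre_level_set:
  "{x. legendre_transform \<Psi> x \<le> ereal c} = (\<Inter>t. {x. t * x - \<Psi> t \<le> c})"
  by (auto simp: legendre_transform_def SUP_le_iff)

text \<open>
  Level sets are intersections of closed half-lines, hence closed; the two half-lines for
  \<open>t = 1\<close> and \<open>t = - 1\<close> already bound them.
\<close>

lemma legendre_good_rate_function:
  assumes "\<Psi> 0 = 0"
  shows "good_rate_function (legendre_transform \<Psi>)"
  unfolding good_rate_function_def rate_function_def
proof (intro conjI allI)
  fix x c
  show "0 \<le> legendre_transform \<Psi> x" using assms by (rule legendre_nonneg)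
  show "legendre_transform \<Psi> x \<le> Liminf (at x) (legendre_transform \<Psi>)"
    unfolding le_Liminf_iff
  proof (intro allI impI)
    fix y assume "y < legendre_transform \<Psi> x"
    then obtain t where t: "y < ereal (t * x - \<Psi> t)"
      by (auto simp: legendre_transform_def less_SUP_iff)
    have "((\<lambda>z. ereal (t * z - \<Psi> t)) \<longlongrightarrow> ereal (t * x - \<Psi> t)) (at x)"
      by (intro tendsto_intros)
    from order_tendstoD(1)[OF this t]
    show "eventually (\<lambda>z. y < legendre_transform \<Psi> z) (at x)"
      by eventually_elim (use legendre_upper less_le_trans in blast)
  qed
  show "compact {x. legendre_transform \<Psi> x \<le> ereal c}"
    unfolding compact_eq_bounded_closed
  proof
    have "\<bar>x\<bar> \<le> c + \<bar>\<Psi> 1\<bar> + \<bar>\<Psi> (- 1)\<bar>" if "legendre_transform \<Psi> x \<le> ereal c" for x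
    proof -
      have "1 * x - \<Psi> 1 \<le> c" "- 1 * x - \<Psi> (- 1) \<le> c"
        using that unfolding legendre_transform_def SUP_le_iff ereal_less_eq(3) by blast+
      then show ?thesis by auto
    qed
    then show "bounded {x. legendre_transform \<Psi> x \<le> ereal c}"
      by (intro boundedI) auto
    show "closed {x. legendre_transform \<Psi> x \<le> ereal c}"
      unfolding legendre_level_set
      by (intro closed_INT ballI closed_Collect_le continuous_intros)
  qed
qed

text \<open>
  A supremum of affine functions is convex.
\<close>

lemma legendre_convex:
  assumes "\<Psi> 0 = 0"
  shows "convex_ereal (legendre_transform \<Psi>)"
  unfolding convex_ereal_def
proof (intro allI impI)
  fix x y u v :: real assume uv: "0 \<le> u" "0 \<le> v" "u + v = 1"
  note nn = legendre_nonneg[of \<Psi>, OF assms]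
  show "legendre_transform \<Psi> (u * x + v * y)
      \<le> ereal u * legendre_transform \<Psi> x + ereal v * legendre_transform \<Psi> y"
    unfolding legendre_transform_def[of _ "u * x + v * y"]
  proof (rule SUP_least)
    fix t
    have "t * (u * x + v * y) - \<Psi> t = u * (t * x - \<Psi> t) + v * (t * y - \<Psi> t)"
    proof -
      have "u * \<Psi> t + v * \<Psi> t = (u + v) * \<Psi> t" by (simp only: distrib_right)
      then have "u * \<Psi> t + v * \<Psi> t = \<Psi> t" using uv by simp
      then show ?thesis by (simp add: algebra_simps)
    qed
    then have "ereal (t * (u * x + v * y) - \<Psi> t)
        = ereal u * ereal (t * x - \<Psi> t) + ereal v * ereal (t * y - \<Psi> t)" by simp
    also have "\<dots> \<le> ereal u * legendre_transform \<Psi> x + ereal v * legendre_transform \<Psi> y"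
      using uv by (intro add_mono ereal_mult_left_mono legendre_upper) auto
    finally show "ereal (t * (u * x + v * y) - \<Psi> t)
      \<le> ereal u * legendre_transform \<Psi> x + ereal v * legendre_transform \<Psi> y" .
  qed
qed

section \<open>The Gaertner-Ellis theorem on the line\<close>

lemma log_ennreal_mono: "x \<le> y \<Longrightarrow> log_ennreal x \<le> log_ennreal y"
  unfolding log_ennreal_def
  by (auto simp: top_unique le_zero_eq enn2real_mono enn2real_positive_iff less_top
      intro!: ln_mono simp flip: zero_less_iff_neq_zero)

lemma log_ennreal_exp: "log_ennreal (ennreal (exp r)) = ereal r"
  by (simp add: log_ennreal_def ennreal_eq_0_iff not_le)

lemma scaled_log_le:
  assumes "x \<le> ennreal (exp (real n * c))" "n \<ge> 1"
  shows "ereal (1 / real n) * log_ennreal x \<le> ereal c"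
proof -
  have "ereal (1 / real n) * log_ennreal x \<le> ereal (1 / real n) * ereal (real n * c)"
    using log_ennreal_mono[OF assms(1)] by (intro ereal_mult_left_mono) (auto simp: log_ennreal_exp)
  also have "\<dots> = ereal c" using assms by simp
  finally show ?thesis .
qed

lemma scaled_log_ge:
  assumes "ennreal (exp (real n * c)) \<le> x" "n \<ge> 1"
  shows "ereal c \<le> ereal (1 / real n) * log_ennreal x"
proof -
  have "ereal c = ereal (1 / real n) * ereal (real n * c)" using assms by simp
  also have "\<dots> \<le> ereal (1 / real n) * log_ennreal x"
    using log_ennreal_mono[OF assms(1)] by (intro ereal_mult_left_mono) (auto simp: log_ennreal_exp)
  finally show ?thesis .
qed

text \<open>
  The hypotheses of the Gaertner-Ellis theorem: \<open>L n\<close> is the logarithmic moment generating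
  function of \<open>\<mu> n\<close>, rescaled by \<open>n\<close> in argument and value, and the limit \<open>\<Psi>\<close> is finite and
  differentiable on all of \<open>\<real>\<close>.  Then \<open>\<Psi>' 0\<close> is the point where \<open>\<mu> n\<close> concentrates and the rate vanishes.
\<close>

locale scaled_cgf_limit =
  fixes \<mu> :: "nat \<Rightarrow> real measure" and L :: "nat \<Rightarrow> real \<Rightarrow> real" and \<Psi> \<Psi>' :: "real \<Rightarrow> real"
  assumes prob: "\<And>n. n \<ge> 1 \<Longrightarrow> prob_space (\<mu> n)"
    and sets_mu: "\<And>n. n \<ge> 1 \<Longrightarrow> sets (\<mu> n) = sets borel"
    and mgf: "\<And>n t. n \<ge> 1 \<Longrightarrow>
      (\<integral>\<^sup>+ x. ennreal (exp (real n * t * x)) \<partial>\<mu> n) = ennreal (exp (real n * L n t))"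
    and lim: "\<And>t. (\<lambda>n. L n t) \<longlonglongrightarrow> \<Psi> t"
    and convex: "convex_on UNIV \<Psi>"
    and deriv: "\<And>t. (\<Psi> has_real_derivative \<Psi>' t) (at t)"
    and zero: "\<Psi> 0 = 0"
begin

text \<open>
  Chernoff's bound for the measure with density \<open>exp (n * t * x)\<close>.  With \<open>t = 0\<close> it bounds the
  tails of \<open>\<mu> n\<close>, with \<open>t \<noteq> 0\<close> those of the exponentially tilted measure.
\<close>

lemma tilted_chernoff:
  assumes n: "n \<ge> 1" and A: "A \<in> sets borel" and c: "\<And>x. x \<in> A \<Longrightarrow> c \<le> s * x"
  shows "(\<integral>\<^sup>+ x. ennreal (exp (real n * t * x)) * indicator A x \<partial>\<mu> n)
    \<le> ennreal (exp (real n * (L n (t + s) - c)))"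
proof -
  note sets_mu[OF n, measurable_cong]
  have "(\<integral>\<^sup>+ x. ennreal (exp (real n * t * x)) * indicator A x \<partial>\<mu> n)
    \<le> (\<integral>\<^sup>+ x. ennreal (exp (- (real n * c))) * ennreal (exp (real n * (t + s) * x)) \<partial>\<mu> n)"
  proof (intro nn_integral_mono)
    fix x
    have "exp (real n * t * x) \<le> exp (- (real n * c)) * exp (real n * (t + s) * x)" if "x \<in> A"
      using mult_left_mono[OF c[OF that], of "real n"]
      by (simp add: exp_add[symmetric] algebra_simps)
    then show "ennreal (exp (real n * t * x)) * indicator A x
      \<le> ennreal (exp (- (real n * c))) * ennreal (exp (real n * (t + s) * x))"
      by (auto simp: indicator_def ennreal_mult'[symmetric] intro!: ennreal_leI)
  qed
  also have "\<dots> = ennreal (exp (- (real n * c))) * ennreal (exp (real n * L n (t + s)))"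
    by (subst nn_integral_cmult) (auto simp: mgf[OF n])
  also have "\<dots> = ennreal (exp (real n * (L n (t + s) - c)))"
    by (simp add: ennreal_mult'[symmetric] exp_add[symmetric] algebra_simps)
  finally show ?thesis .
qed

text \<open>
  The graph of \<open>\<Psi>\<close> lies above its tangent at \<open>0\<close>; in other words, the rate at \<open>\<Psi>' 0\<close> is zero.
\<close>

lemma mean_slope: "t * \<Psi>' 0 - \<Psi> t \<le> 0"
  using convex_on_imp_above_tangent[OF convex _ _ _ deriv, of 0 t] zero
  by (simp add: algebra_simps)

lemma tail_decay:
  assumes n: "eventually (\<lambda>n. L n t < t * b - c) sequentially"
    and A: "A \<in> sets borel" "\<And>x. x \<in> A \<Longrightarrow> t * b \<le> t * x"
  shows "eventually (\<lambda>n. emeasure (\<mu> n) A \<le> ennreal (exp (- (real n * c)))) sequentially"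
  using n eventually_ge_at_top[of 1]
proof eventually_elim
  case (elim n)
  have "emeasure (\<mu> n) A = (\<integral>\<^sup>+ x. ennreal (exp (real n * 0 * x)) * indicator A x \<partial>\<mu> n)"
    using sets_mu[OF elim(2)] A by simp
  also have "\<dots> \<le> ennreal (exp (real n * (L n (0 + t) - t * b)))"
    by (rule tilted_chernoff) (use elim A in auto)
  also have "\<dots> \<le> ennreal (exp (- (real n * c)))"
  proof (rule ennreal_leI)
    have "real n * (L n (0 + t) - t * b) \<le> real n * (- c)"
      using elim by (intro mult_left_mono) auto
    then show "exp (real n * (L n (0 + t) - t * b)) \<le> exp (- (real n * c))" by simp
  qed
  finally show ?case .
qed

text \<open>
  For \<open>c < 0\<close> the choice \<open>t = 0\<close> suffices.  Otherwise some \<open>t\<close> witnesses the rate at \<open>b\<close>, and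
  \<open>mean_slope\<close> forces the sign of \<open>t\<close> to be that of \<open>b - \<Psi>' 0\<close>, so Chernoff's bound with this \<open>t\<close>
  points away from \<open>\<Psi>' 0\<close> and covers everything beyond \<open>b\<close>.
\<close>

lemma tail_decay_of_rate:
  assumes b: "ereal c < legendre_transform \<Psi> b"
    and A: "A \<in> sets borel" "\<And>x. x \<in> A \<Longrightarrow> (\<Psi>' 0 \<le> b \<and> b \<le> x) \<or> (x \<le> b \<and> b \<le> \<Psi>' 0)"
  shows "eventually (\<lambda>n. emeasure (\<mu> n) A \<le> ennreal (exp (- (real n * c)))) sequentially"
proof (cases "c < 0")
  case True
  have "eventually (\<lambda>n. L n 0 < 0 * b - c) sequentially"
    using lim[of 0] True zero by (auto simp: order_tendsto_iff)
  then show ?thesis by (rule tail_decay) (use A in auto)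
next
  case False
  from b obtain t where t: "c < t * b - \<Psi> t"
    by (auto simp: legendre_transform_def less_SUP_iff)
  have "0 < t * b - t * \<Psi>' 0" using t mean_slope[of t] False by linarith
  then have pos: "0 < t * (b - \<Psi>' 0)" by (simp add: algebra_simps)
  have "eventually (\<lambda>n. L n t < t * b - c) sequentially"
    using lim[of t] t by (intro order_tendstoD(2)) auto
  then show ?thesis
  proof (rule tail_decay)
    fix x assume "x \<in> A"
    from A(2)[OF this] show "t * b \<le> t * x"
      using pos by (auto simp: zero_less_mult_iff intro: mult_left_mono mult_left_mono_neg)
  qed (use A in auto)
qed

text \<open>
  A closed set splits at \<open>\<Psi>' 0\<close> into a right and a left part.  The point of each part nearest to
  \<open>\<Psi>' 0\<close> belongs to the set, so its rate is at least the infimum, and the part lies in the tail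
  beyond this point.
\<close>

lemma upper_bound:
  assumes F: "closed F"
  shows "limsup (\<lambda>n. ereal (1 / real n) * log_ennreal (emeasure (\<mu> n) F))
    \<le> - (INF x\<in>F. legendre_transform \<Psi> x)"
proof (rule ccontr)
  assume "\<not> ?thesis"
  then have "- (INF x\<in>F. legendre_transform \<Psi> x)
      < limsup (\<lambda>n. ereal (1 / real n) * log_ennreal (emeasure (\<mu> n) F))" by simp
  then obtain z where z: "- (INF x\<in>F. legendre_transform \<Psi> x) < ereal z"
    "ereal z < limsup (\<lambda>n. ereal (1 / real n) * log_ennreal (emeasure (\<mu> n) F))"
    using ereal_dense2 by blast
  from ereal_dense2[OF z(1)] obtain z' where
    z': "- (INF x\<in>F. legendre_transform \<Psi> x) < ereal z'" "z' < z" by auto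
  have rate: "ereal (- z') < legendre_transform \<Psi> x" if "x \<in> F" for x
  proof -
    have "ereal (- z') < (INF x\<in>F. legendre_transform \<Psi> x)"
      using z'(1) by (simp add: ereal_uminus_less_reorder flip: uminus_ereal.simps)
    also have "\<dots> \<le> legendre_transform \<Psi> x" using that by (rule INF_lower)
    finally show ?thesis .
  qed
  define R where "R = F \<inter> {\<Psi>' 0..}"
  define S where "S = F \<inter> {..\<Psi>' 0}"
  have FRS: "F = R \<union> S" by (auto simp: R_def S_def)
  have cl: "closed R" "closed S" using F by (auto simp: R_def S_def)
  have meas: "R \<in> sets borel" "S \<in> sets borel" using cl by auto
  have R: "eventually (\<lambda>n. emeasure (\<mu> n) R \<le> ennreal (exp (- (real n * - z')))) sequentially"
  proof (cases "R = {}")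
    case False
    have bdd: "bdd_below R" by (auto simp: R_def)
    have "Inf R \<in> R" using closed_contains_Inf[OF False bdd cl(1)] .
    then show ?thesis
      by (intro tail_decay_of_rate[of _ "Inf R"] rate meas)
         (auto simp: R_def intro!: cInf_lower bdd[unfolded R_def])
  qed simp
  have S: "eventually (\<lambda>n. emeasure (\<mu> n) S \<le> ennreal (exp (- (real n * - z')))) sequentially"
  proof (cases "S = {}")
    case False
    have bdd: "bdd_above S" by (auto simp: S_def)
    have "Sup S \<in> S" using closed_contains_Sup[OF False bdd cl(2)] .
    then show ?thesis
      by (intro tail_decay_of_rate[of _ "Sup S"] rate meas)
         (auto simp: S_def intro!: cSup_upper bdd[unfolded S_def])
  qed simp
  have "eventually (\<lambda>n. ln 2 / (z - z') \<le> real n) sequentially"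
    using filterlim_real_sequentially by (simp add: filterlim_at_top)
  then have "eventually (\<lambda>n. ereal (1 / real n) * log_ennreal (emeasure (\<mu> n) F) \<le> ereal z) sequentially"
    using R S eventually_ge_at_top[of 1]
  proof eventually_elim
    case (elim n)
    have "emeasure (\<mu> n) F \<le> emeasure (\<mu> n) R + emeasure (\<mu> n) S"
      unfolding FRS using meas sets_mu[OF elim(4)] by (intro emeasure_subadditive) auto
    also have "\<dots> \<le> ennreal (exp (real n * z')) + ennreal (exp (real n * z'))"
      using elim by (intro add_mono) auto
    also have "\<dots> = ennreal (exp (ln 2) * exp (real n * z'))"
      by (subst ennreal_plus[symmetric]) auto
    also have "\<dots> \<le> ennreal (exp (real n * z))"
    proof (rule ennreal_leI)
      have "ln 2 \<le> real n * (z - z')" using elim(1) z'(2) by (simp add: field_simps)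
      then show "exp (ln 2) * exp (real n * z') \<le> exp (real n * z)"
        unfolding exp_add[symmetric] by (simp add: algebra_simps)
    qed
    finally show ?case using elim by (intro scaled_log_le) auto
  qed
  then have "limsup (\<lambda>n. ereal (1 / real n) * log_ennreal (emeasure (\<mu> n) F)) \<le> ereal z"
    by (rule Limsup_bounded)
  with z(2) show False by simp
qed

text \<open>
  The total mass of \<open>exp (n * t * x)\<close> under \<open>\<mu> n\<close> is \<open>exp (n * L n t)\<close>.  When
  \<open>\<Psi> (t + s) - \<Psi> t < c\<close>, the tilted Chernoff bound is smaller by an exponential factor, in particular
  eventually by the factor \<open>4\<close>.
\<close>

lemma tilted_tail_negligible:
  assumes A: "A \<in> sets borel" "\<And>x. x \<in> A \<Longrightarrow> c \<le> s * x" and s: "\<Psi> (t + s) - \<Psi> t < c"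
  shows "eventually (\<lambda>n. (\<integral>\<^sup>+ x. ennreal (exp (real n * t * x)) * indicator A x \<partial>\<mu> n)
    \<le> ennreal (exp (real n * L n t) / 4)) sequentially"
proof -
  define \<eta> where "\<eta> = (c - (\<Psi> (t + s) - \<Psi> t)) / 2"
  have \<eta>: "\<eta> > 0" using s by (simp add: \<eta>_def)
  have "(\<lambda>n. L n (t + s) - L n t) \<longlonglongrightarrow> \<Psi> (t + s) - \<Psi> t"
    by (intro tendsto_diff lim)
  moreover have "\<Psi> (t + s) - \<Psi> t < c - \<eta>" using s by (simp add: \<eta>_def field_simps)
  ultimately have 1: "eventually (\<lambda>n. L n (t + s) - L n t < c - \<eta>) sequentially"
    by (rule order_tendstoD)
  have "eventually (\<lambda>n. ln 4 / \<eta> \<le> real n) sequentially"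
    using filterlim_real_sequentially by (simp add: filterlim_at_top)
  then show ?thesis using 1 eventually_ge_at_top[of 1]
  proof eventually_elim
    case (elim n)
    have "(\<integral>\<^sup>+ x. ennreal (exp (real n * t * x)) * indicator A x \<partial>\<mu> n)
      \<le> ennreal (exp (real n * (L n (t + s) - c)))"
      by (rule tilted_chernoff) (use elim A in auto)
    also have "\<dots> \<le> ennreal (exp (real n * L n t) * exp (- ln 4))"
    proof (rule ennreal_leI)
      have "real n * (L n (t + s) - c) \<le> real n * (L n t - \<eta>)"
        using elim by (intro mult_left_mono) auto
      moreover have "ln 4 \<le> real n * \<eta>" using elim(1) \<eta> by (simp add: field_simps)
      ultimately show "exp (real n * (L n (t + s) - c)) \<le> exp (real n * L n t) * exp (- ln 4)"
        unfolding exp_add[symmetric] by (simp add: algebra_simps)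
    qed
    finally show ?case by (simp add: exp_minus field_simps)
  qed
qed

text \<open>
  Tilting by \<open>exp (n * t * x)\<close> moves the centre to \<open>\<Psi>' t\<close>: as \<open>\<Psi> (t + s) - \<Psi> t\<close> is
  \<open>s * \<Psi>' t\<close> up to \<open>o(s)\<close>, both tails away from \<open>\<Psi>' t\<close> are negligible, so at least half of the tilted
  mass sits near \<open>\<Psi>' t\<close>.  There the density is about \<open>exp (n * t * \<Psi>' t)\<close>, and dividing by it gives
  the bound for \<open>\<mu> n\<close>.
\<close>

lemma lower_bound_exposed:
  assumes G: "open G" and y: "\<Psi>' t \<in> G"
  shows "ereal (\<Psi> t - t * \<Psi>' t)
    \<le> liminf (\<lambda>n. ereal (1 / real n) * log_ennreal (emeasure (\<mu> n) G))"
proof (rule ccontr)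
  define y where "y = \<Psi>' t"
  assume "\<not> ?thesis"
  then have "liminf (\<lambda>n. ereal (1 / real n) * log_ennreal (emeasure (\<mu> n) G))
      < ereal (\<Psi> t - t * y)" by (simp add: y_def)
  then obtain z where z: "liminf (\<lambda>n. ereal (1 / real n) * log_ennreal (emeasure (\<mu> n) G)) < ereal z"
    "ereal z < ereal (\<Psi> t - t * y)" using ereal_dense2 by blast
  define \<epsilon> where "\<epsilon> = (\<Psi> t - t * y - z) / 3"
  have \<epsilon>: "\<epsilon> > 0" using z by (simp add: \<epsilon>_def)
  from G y obtain r where r: "r > 0" "ball y r \<subseteq> G" unfolding open_contains_ball y_def by blast
  \<comment> \<open>On \<open>(y - d, y + d)\<close> the exponent \<open>t * x\<close> varies by at most \<open>\<epsilon>\<close>.\<close>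
  define d where "d = min r (\<epsilon> / (\<bar>t\<bar> + 1))"
  have d: "d > 0" "d \<le> r" using r \<epsilon> by (auto simp: d_def)
  have td: "\<bar>t\<bar> * d \<le> \<epsilon>"
  proof -
    have "\<bar>t\<bar> * d \<le> (\<bar>t\<bar> + 1) * (\<epsilon> / (\<bar>t\<bar> + 1))"
      using d by (intro mult_mono) (auto simp: d_def)
    then show ?thesis by simp
  qed
  have shift: "((\<lambda>s. \<Psi> (t + s) - s * c) has_real_derivative (y - c)) (at 0)" for c
  proof -
    have "(\<Psi> has_real_derivative \<Psi>' t) (at (0 + t))" using deriv[of t] by simp
    then have "((\<lambda>s. \<Psi> (t + s)) has_real_derivative \<Psi>' t) (at 0)"
      unfolding DERIV_shift by (simp add: add.commute)
    then show ?thesis by (auto intro!: derivative_eq_intros simp: y_def)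
  qed
  obtain s where s: "s > 0" "\<Psi> (t + s) - \<Psi> t < s * (y + d)"
  proof -
    from DERIV_neg_dec_right[OF shift[of "y + d"]] d obtain e where
      "e > 0" "\<forall>h>0. h < e \<longrightarrow> \<Psi> (t + h) - h * (y + d) < \<Psi> t" by auto
    then show ?thesis using that[of "e / 2"] by (auto dest: spec[of _ "e/2"])
  qed
  obtain s' where s': "s' > 0" "\<Psi> (t + (- s')) - \<Psi> t < - s' * (y - d)"
  proof -
    from DERIV_pos_inc_left[OF shift[of "y - d"]] d obtain e where
      "e > 0" "\<forall>h>0. h < e \<longrightarrow> \<Psi> (t - h) + h * (y - d) < \<Psi> t" by auto
    then show ?thesis using that[of "e / 2"] by (auto dest: spec[of _ "e/2"])
  qed
  \<comment> \<open>\<open>s\<close> and \<open>- s'\<close> are the tilts for the right and left tails.\<close>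
  define A where "A = {y - d<..<y + d}"
  have AG: "A \<subseteq> G" using r d by (auto simp: A_def dist_real_def subset_iff abs_less_iff)
  have R: "eventually (\<lambda>n. (\<integral>\<^sup>+ x. ennreal (exp (real n * t * x)) * indicator {y + d..} x \<partial>\<mu> n)
    \<le> ennreal (exp (real n * L n t) / 4)) sequentially"
    by (rule tilted_tail_negligible[of _ "s * (y + d)" s]) (use s in auto)
  have S: "eventually (\<lambda>n. (\<integral>\<^sup>+ x. ennreal (exp (real n * t * x)) * indicator {..y - d} x \<partial>\<mu> n)
    \<le> ennreal (exp (real n * L n t) / 4)) sequentially"
    by (rule tilted_tail_negligible[of _ "- s' * (y - d)" "- s'"]) (use s' in auto)
  have lt: "eventually (\<lambda>n. \<Psi> t - \<epsilon> / 2 < L n t) sequentially"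
    using lim[of t] \<epsilon> by (intro order_tendstoD(1)) auto
  have "eventually (\<lambda>n. 2 * ln 2 / \<epsilon> \<le> real n) sequentially"
    using filterlim_real_sequentially by (simp add: filterlim_at_top)
  then have "eventually (\<lambda>n. ereal z \<le> ereal (1 / real n) * log_ennreal (emeasure (\<mu> n) G)) sequentially"
    using R S lt eventually_ge_at_top[of 1]
  proof eventually_elim
    case (elim n)
    note n = elim(5)
    note sets_mu[OF n, measurable_cong]
    interpret prob_space "\<mu> n" using prob n by auto
    define E where "E = exp (real n * L n t)"
    define K where "K = exp (real n * (t * y + \<epsilon>))"
    let ?e = "\<lambda>x. ennreal (exp (real n * t * x))"
    have "ennreal E = (\<integral>\<^sup>+ x. ?e x \<partial>\<mu> n)" using mgf[OF n, of t] by (simp add: E_def)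
    also have "\<dots> = (\<integral>\<^sup>+ x. ?e x * indicator A x + ?e x * indicator {y + d..} x
        + ?e x * indicator {..y - d} x \<partial>\<mu> n)"
      using d by (intro nn_integral_cong) (auto simp: A_def indicator_def)
    also have "\<dots> = (\<integral>\<^sup>+ x. ?e x * indicator A x \<partial>\<mu> n)
        + (\<integral>\<^sup>+ x. ?e x * indicator {y + d..} x \<partial>\<mu> n) + (\<integral>\<^sup>+ x. ?e x * indicator {..y - d} x \<partial>\<mu> n)"
      unfolding A_def by (subst nn_integral_add; (subst nn_integral_add)?) auto
    also have "\<dots> \<le> (\<integral>\<^sup>+ x. ennreal K * indicator A x \<partial>\<mu> n) + ennreal (E / 4) + ennreal (E / 4)"
    proof (intro add_mono nn_integral_mono)
      fix x
      have "exp (real n * t * x) \<le> K" if "x \<in> A"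
      proof -
        have "t * x - t * y \<le> \<bar>t\<bar> * \<bar>x - y\<bar>" by (simp flip: abs_mult right_diff_distrib)
        also have "\<dots> \<le> \<bar>t\<bar> * d" using that by (intro mult_left_mono) (auto simp: A_def abs_le_iff)
        finally have "t * x \<le> t * y + \<epsilon>" using td by linarith
        then have "real n * (t * x) \<le> real n * (t * y + \<epsilon>)" by (intro mult_left_mono) auto
        then show ?thesis by (simp add: K_def mult.assoc)
      qed
      then show "?e x * indicator A x \<le> ennreal K * indicator A x"
        by (auto simp: indicator_def intro: ennreal_leI)
    qed (use elim in \<open>auto simp: E_def\<close>)
    also have "(\<integral>\<^sup>+ x. ennreal K * indicator A x \<partial>\<mu> n) = ennreal (K * prob A)"
      by (subst nn_integral_cmult_indicator) (auto simp: A_def K_def emeasure_eq_measure ennreal_mult)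
    also have "ennreal (K * prob A) + ennreal (E / 4) + ennreal (E / 4) = ennreal (K * prob A + E / 2)"
      by (simp add: E_def K_def flip: ennreal_plus)
    finally have "E \<le> K * prob A + E / 2"
      by (subst (asm) ennreal_le_iff) (auto simp: E_def K_def)
    then have "E / 2 / K \<le> prob A" by (simp add: K_def field_simps)
    moreover have "exp (real n * z) \<le> E / 2 / K"
    proof -
      have "real n * (\<Psi> t - \<epsilon> / 2) \<le> real n * L n t" using elim by (intro mult_left_mono) auto
      moreover have "ln 2 \<le> real n * (\<epsilon> / 2)" using elim(1) \<epsilon> by (simp add: field_simps)
      moreover have "0 \<le> real n * \<epsilon>" using \<epsilon> by simp
      moreover have "real n * z = real n * (\<Psi> t - \<epsilon> / 2) - real n * (\<epsilon> / 2)
          - real n * (t * y + \<epsilon>) - real n * \<epsilon>"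
      proof -
        have "\<Psi> t = z + t * y + 3 * \<epsilon>" by (simp add: \<epsilon>_def field_simps)
        then show ?thesis by (simp only:) (simp add: algebra_simps)
      qed
      ultimately have "real n * z \<le> real n * L n t - ln 2 - real n * (t * y + \<epsilon>)"
        by linarith
      then have "exp (real n * z) \<le> exp (real n * L n t - ln 2 - real n * (t * y + \<epsilon>))" by simp
      also have "\<dots> = E / 2 / K" by (simp add: E_def K_def exp_diff)
      finally show ?thesis .
    qed
    ultimately have "ennreal (exp (real n * z)) \<le> emeasure (\<mu> n) A"
      unfolding emeasure_eq_measure by (intro ennreal_leI) linarith
    also have "\<dots> \<le> emeasure (\<mu> n) G" using AG G by (intro emeasure_mono) auto
    finally show ?case using n by (intro scaled_log_ge) auto
  qed
  then have "ereal z \<le> liminf (\<lambda>n. ereal (1 / real n) * log_ennreal (emeasure (\<mu> n) G))"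
    by (rule Liminf_bounded)
  with z(1) show False by simp
qed

text \<open>
  Let \<open>y\<close> lie strictly between \<open>x\<close> and \<open>\<Psi>' 0\<close>.  Since the rate is finite at \<open>x\<close> and zero at \<open>\<Psi>' 0\<close>,
  the function \<open>t * y - \<Psi> t\<close> is negative for large \<open>\<bar>t\<bar>\<close>: on one side by comparison with
  \<open>t * x - \<Psi> t\<close>, on the other side by comparison with \<open>t * \<Psi>' 0 - \<Psi> t\<close>.  Hence it attains its maximum,
  where \<open>\<Psi>' t = y\<close>.
\<close>

lemma slope_attained:
  assumes x: "legendre_transform \<Psi> x \<le> ereal c" "x \<noteq> \<Psi>' 0" and l: "0 < l" "l < 1"
  shows "\<exists>t. \<Psi>' t = (1 - l) * x + l * \<Psi>' 0"
proof -
  define m where "m = \<Psi>' 0"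
  define y where "y = (1 - l) * x + l * m"
  define h where "h t = t * y - \<Psi> t" for t
  have xy: "x - y = l * (x - m)" "y - m = (1 - l) * (x - m)"
    by (auto simp: y_def algebra_simps)
  have xm: "x \<noteq> m" using x by (simp add: m_def)
  have h1: "h t \<le> c - t * (x - y)" for t
  proof -
    have "ereal (t * x - \<Psi> t) \<le> ereal c" using legendre_upper[of t x \<Psi>] x(1) by (rule order_trans)
    then show ?thesis by (simp add: h_def algebra_simps)
  qed
  have h2: "h t \<le> t * (y - m)" for t
    using mean_slope[of t] by (simp add: h_def m_def algebra_simps)
  have h0: "h 0 = 0" by (simp add: h_def zero)
  have c0: "0 \<le> c" using h1[of 0] h0 by simp
  \<comment> \<open>For \<open>\<bar>t\<bar> > R\<close> the bound \<open>h1\<close> or \<open>h2\<close>, depending on the sign of \<open>t\<close>, shows \<open>h t < 0 = h 0\<close>.\<close>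
  define R where "R = (c + 1) / \<bar>x - y\<bar>"
  have xy0: "x - y \<noteq> 0" using xm l by (simp add: xy)
  have R: "R > 0" using c0 xy0 by (simp add: R_def)
  have out: "h t < 0" if t: "R < \<bar>t\<bar>" for t
  proof (cases "t * (x - m) > 0")
    case True
    have "c + 1 = R * \<bar>x - y\<bar>" using xy0 by (simp add: R_def)
    also have "\<dots> \<le> \<bar>t\<bar> * \<bar>x - y\<bar>" using t by (intro mult_right_mono) auto
    also have "\<dots> = \<bar>t * (x - m)\<bar> * l" using l by (simp add: xy abs_mult)
    also have "\<dots> = t * (x - y)" using True by (simp add: xy)
    finally show ?thesis using h1[of t] by linarith
  next
    case False
    have "t \<noteq> 0" using t R by auto
    then have "t * (x - m) < 0" using False xm
      by (smt (verit) mult_eq_0_iff right_minus_eq)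
    then have "t * (y - m) < 0" using l
      by (metis (no_types, opaque_lifting) diff_gt_0_iff_gt mult.left_commute mult_pos_neg xy(2))
    with h2[of t] show ?thesis by linarith
  qed
  have cont: "continuous_on {-R..R} h"
    unfolding h_def
    by (intro continuous_intros continuous_at_imp_continuous_on ballI DERIV_isCont[OF deriv])
  from continuous_attains_sup[OF _ _ cont] R obtain t where
    t: "t \<in> {-R..R}" "\<And>u. u \<in> {-R..R} \<Longrightarrow> h u \<le> h t" by auto
  have max: "h u \<le> h t" for u
  proof (cases "u \<in> {-R..R}")
    case False
    then have "h u < 0" by (intro out) auto
    also have "0 \<le> h t" using t(2)[of 0] R h0 by auto
    finally show ?thesis by simp
  qed (use t in auto)
  have "(h has_real_derivative (y - \<Psi>' t)) (at t)"
    unfolding h_def by (auto intro!: derivative_eq_intros deriv)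
  from DERIV_local_max[OF this, of 1] max have "y - \<Psi>' t = 0" by auto
  then show ?thesis by (auto simp: y_def m_def)
qed

text \<open>
  A point of finite rate need not be a value of \<open>\<Psi>'\<close>, for instance at the boundary of the range of
  \<open>\<Psi>'\<close>.  But every point strictly between it and \<open>\<Psi>' 0\<close> is one, and by convexity its rate is no
  larger; such points exist in every neighbourhood.
\<close>

lemma lower_bound:
  assumes G: "open G" and x: "x \<in> G"
  shows "- legendre_transform \<Psi> x
    \<le> liminf (\<lambda>n. ereal (1 / real n) * log_ennreal (emeasure (\<mu> n) G))"
proof (cases "legendre_transform \<Psi> x = \<infinity>")
  case False
  then obtain c where c: "legendre_transform \<Psi> x = ereal c"
    using legendre_nonneg[of \<Psi> x, OF zero] by (cases "legendre_transform \<Psi> x") auto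
  have c0: "0 \<le> c" using legendre_nonneg[of \<Psi> x, OF zero] by (simp add: c)
  have "\<exists>t. \<Psi>' t \<in> G \<and> t * \<Psi>' t - \<Psi> t \<le> c"
  proof (cases "x = \<Psi>' 0")
    case True
    then show ?thesis using x c0 zero by (intro exI[of _ 0]) auto
  next
    case xm: False
    have "((\<lambda>l. (1 - l) * x + l * \<Psi>' 0) \<longlongrightarrow> (1 - 0) * x + 0 * \<Psi>' 0) (at_right 0)"
      by (intro tendsto_intros)
    then have "eventually (\<lambda>l. (1 - l) * x + l * \<Psi>' 0 \<in> G) (at_right 0)"
      by (rule topological_tendstoD) (use G x in auto)
    moreover have "eventually (\<lambda>l::real. l \<in> {0<..<1}) (at_right 0)"
      by (rule eventually_at_right_real) simp
    ultimately have "eventually (\<lambda>l. (1 - l) * x + l * \<Psi>' 0 \<in> G \<and> 0 < l \<and> l < 1) (at_right 0)"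
      by eventually_elim auto
    then obtain l where l: "(1 - l) * x + l * \<Psi>' 0 \<in> G" "0 < l" "l < 1"
      using eventually_happens[of _ "at_right (0::real)"] by auto
    from slope_attained[of x c l] c xm l obtain t where t: "\<Psi>' t = (1 - l) * x + l * \<Psi>' 0" by auto
    have "t * x - \<Psi> t \<le> c" using legendre_upper[of t x \<Psi>] by (simp add: c)
    then have "(1 - l) * (t * x - \<Psi> t) \<le> (1 - l) * c" using l by (intro mult_left_mono) auto
    moreover have "l * (t * \<Psi>' 0 - \<Psi> t) \<le> 0"
      using mean_slope[of t] l by (intro mult_nonneg_nonpos) auto
    moreover have "(1 - l) * c \<le> c" using c0 l by (simp add: mult_left_le_one_le)
    moreover have "t * \<Psi>' t - \<Psi> t = (1 - l) * (t * x - \<Psi> t) + l * (t * \<Psi>' 0 - \<Psi> t)"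
      by (simp add: t algebra_simps)
    ultimately have "t * \<Psi>' t - \<Psi> t \<le> c" by linarith
    then show ?thesis using t l by (intro exI[of _ t]) auto
  qed
  then obtain t where t: "\<Psi>' t \<in> G" "t * \<Psi>' t - \<Psi> t \<le> c" by auto
  have "- legendre_transform \<Psi> x \<le> ereal (\<Psi> t - t * \<Psi>' t)" using t by (simp add: c)
  also have "\<dots> \<le> liminf (\<lambda>n. ereal (1 / real n) * log_ennreal (emeasure (\<mu> n) G))"
    by (rule lower_bound_exposed) (use G t in auto)
  finally show ?thesis .
qed simp

theorem gaertner_ellis: "satisfies_LDP \<mu> (legendre_transform \<Psi>)"
  unfolding satisfies_LDP_def
proof (intro conjI allI impI ballI)
  show "rate_function (legendre_transform \<Psi>)"
    using legendre_good_rate_function[of \<Psi>] zero by (simp add: good_rate_function_def)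
  fix \<Gamma> :: "real set"
  show "- (INF x\<in>interior \<Gamma>. legendre_transform \<Psi> x)
    \<le> liminf (\<lambda>n. ereal (1 / real n) * log_ennreal (emeasure (\<mu> n) (interior \<Gamma>)))"
    unfolding ereal_SUP_uminus_eq[symmetric]
    by (rule SUP_least) (auto intro!: lower_bound)
  show "limsup (\<lambda>n. ereal (1 / real n) * log_ennreal (emeasure (\<mu> n) (closure \<Gamma>)))
    \<le> - (INF x\<in>closure \<Gamma>. legendre_transform \<Psi> x)"
    by (rule upper_bound) simp
  have "liminf (\<lambda>n. ereal (1 / real n) * log_ennreal (emeasure (\<mu> n) (interior \<Gamma>)))
    \<le> liminf (\<lambda>n. ereal (1 / real n) * log_ennreal (emeasure (\<mu> n) (closure \<Gamma>)))"
  proof (rule Liminf_mono)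
    show "eventually (\<lambda>n. ereal (1 / real n) * log_ennreal (emeasure (\<mu> n) (interior \<Gamma>))
      \<le> ereal (1 / real n) * log_ennreal (emeasure (\<mu> n) (closure \<Gamma>))) sequentially"
      using eventually_ge_at_top[of 1]
    proof eventually_elim
      case (elim n)
      have "interior \<Gamma> \<subseteq> closure \<Gamma>" using interior_subset closure_subset by blast
      then show ?case using sets_mu[OF elim]
        by (intro ereal_mult_left_mono log_ennreal_mono emeasure_mono) auto
    qed
  qed
  also have "\<dots> \<le> limsup (\<lambda>n. ereal (1 / real n) * log_ennreal (emeasure (\<mu> n) (closure \<Gamma>)))"
    by (rule Liminf_le_Limsup) simp
  finally show "liminf (\<lambda>n. ereal (1 / real n) * log_ennreal (emeasure (\<mu> n) (interior \<Gamma>)))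
    \<le> limsup (\<lambda>n. ereal (1 / real n) * log_ennreal (emeasure (\<mu> n) (closure \<Gamma>)))" .
qed (use prob sets_mu in auto)

end

section \<open>Rotational symmetry of Gaussian vectors\<close>

lemma sets_std_gaussian [simp, measurable_cong]: "sets std_gaussian = sets borel"
  by (simp add: std_gaussian_def)

lemma space_std_gaussian [simp]: "space std_gaussian = UNIV"
  by (simp add: std_gaussian_def)

lemma prob_space_std_gaussian: "prob_space std_gaussian"
  unfolding std_gaussian_def by (rule prob_space_normal_density) simp

interpretation std_gaussian: prob_space std_gaussian
  by (rule prob_space_std_gaussian)

lemma prob_space_gaussian_vector: "prob_space (\<Pi>\<^sub>M i\<in>J. std_gaussian)"
  by (intro prob_space_PiM prob_space_std_gaussian)

interpretation gaussian_product: product_prob_space "\<lambda>_::nat. std_gaussian" I for I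
  by unfold_locales

abbreviation gaussian_vector :: "nat set \<Rightarrow> (nat \<Rightarrow> real) measure" where
  "gaussian_vector J \<equiv> \<Pi>\<^sub>M i\<in>J. std_gaussian"

text \<open>
  For \<open>a \<noteq> 0\<close> the map is the composition of two transformations that each change one coordinate
  affinely while the other is fixed, so two one-dimensional substitutions and Fubini's theorem give
  the result; the factors \<open>\<bar>a\<bar>\<close> and \<open>1 / \<bar>a\<bar>\<close> cancel.
\<close>

lemma lebesgue_plane_reflection:
  fixes f :: "real \<Rightarrow> real \<Rightarrow> ennreal"
  assumes f [measurable]: "case_prod f \<in> borel_measurable (borel \<Otimes>\<^sub>M borel)"
    and ab: "a\<^sup>2 + b\<^sup>2 = 1"
  shows "(\<integral>\<^sup>+ x. \<integral>\<^sup>+ y. f (a * x + b * y) (b * x - a * y) \<partial>lborel \<partial>lborel)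
    = (\<integral>\<^sup>+ x. \<integral>\<^sup>+ y. f x y \<partial>lborel \<partial>lborel)"
proof (cases "a = 0")
  case True
  with ab have b: "\<bar>b\<bar> = 1" by (simp add: abs_square_eq_1)
  then have b0: "b \<noteq> 0" by auto
  have "(\<integral>\<^sup>+ x. \<integral>\<^sup>+ y. f x y \<partial>lborel \<partial>lborel) = (\<integral>\<^sup>+ x. \<integral>\<^sup>+ y. f x (b * y) \<partial>lborel \<partial>lborel)"
    using b b0 by (subst nn_integral_real_affine[where c=b and t=0]) auto
  also have "\<dots> = (\<integral>\<^sup>+ x. \<integral>\<^sup>+ y. f (b * x) (b * y) \<partial>lborel \<partial>lborel)"
    using b b0 by (subst nn_integral_real_affine[where c=b and t=0]) auto
  also have "\<dots> = (\<integral>\<^sup>+ y. \<integral>\<^sup>+ x. f (b * x) (b * y) \<partial>lborel \<partial>lborel)"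
    by (rule lborel_pair.Fubini') simp
  finally show ?thesis by (simp add: True)
next
  case a: False
  \<comment> \<open>Substitute \<open>p = a * x + b * y\<close> for \<open>x\<close>, with \<open>y\<close> fixed.\<close>
  have inner: "(\<integral>\<^sup>+ p. f p ((b * p - y) / a) \<partial>lborel)
      = ennreal \<bar>a\<bar> * (\<integral>\<^sup>+ x. f (a * x + b * y) (b * x - a * y) \<partial>lborel)" for y
  proof -
    have "(b * (b * y + a * x) - y) / a = b * x - a * y" for x
    proof -
      have "b * (b * y + a * x) - y = a * (b * x) - (1 - b\<^sup>2) * y" by (simp add: algebra_simps power2_eq_square)
      also have "1 - b\<^sup>2 = a\<^sup>2" using ab by simp
      finally show ?thesis using a by (simp add: field_simps power2_eq_square)
    qed
    then show ?thesis
      by (subst nn_integral_real_affine[where c=a and t="b * y"]) (use a in \<open>auto simp: add.commute\<close>)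
  qed
  \<comment> \<open>Substitute \<open>q = (b * p - y) / a\<close> for \<open>y\<close>, with \<open>p\<close> fixed.\<close>
  have outer: "(\<integral>\<^sup>+ q. f p q \<partial>lborel) = ennreal (1 / \<bar>a\<bar>) * (\<integral>\<^sup>+ y. f p ((b * p - y) / a) \<partial>lborel)" for p
    by (subst nn_integral_real_affine[where c="- 1 / a" and t="b * p / a"])
       (use a in \<open>auto simp: diff_divide_distrib\<close>)
  have "ennreal \<bar>a\<bar> * (\<integral>\<^sup>+ x. \<integral>\<^sup>+ y. f (a * x + b * y) (b * x - a * y) \<partial>lborel \<partial>lborel)
      = ennreal \<bar>a\<bar> * (\<integral>\<^sup>+ y. \<integral>\<^sup>+ x. f (a * x + b * y) (b * x - a * y) \<partial>lborel \<partial>lborel)"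
    by (subst lborel_pair.Fubini') auto
  also have "\<dots> = (\<integral>\<^sup>+ y. \<integral>\<^sup>+ p. f p ((b * p - y) / a) \<partial>lborel \<partial>lborel)"
    unfolding inner by (subst nn_integral_cmult) auto
  also have "\<dots> = (\<integral>\<^sup>+ p. \<integral>\<^sup>+ y. f p ((b * p - y) / a) \<partial>lborel \<partial>lborel)"
    by (subst lborel_pair.Fubini') auto
  finally have "ennreal (1 / \<bar>a\<bar>) * (ennreal \<bar>a\<bar> *
      (\<integral>\<^sup>+ x. \<integral>\<^sup>+ y. f (a * x + b * y) (b * x - a * y) \<partial>lborel \<partial>lborel))
      = (\<integral>\<^sup>+ p. \<integral>\<^sup>+ q. f p q \<partial>lborel \<partial>lborel)"
    unfolding outer by (subst nn_integral_cmult) auto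
  then show ?thesis using a by (simp add: mult.assoc[symmetric] ennreal_mult'[symmetric])
qed

lemma nn_integral_std_gaussian:
  assumes [measurable]: "f \<in> borel_measurable borel"
  shows "(\<integral>\<^sup>+ x. f x \<partial>std_gaussian) = (\<integral>\<^sup>+ x. ennreal (std_normal_density x) * f x \<partial>lborel)"
  unfolding std_gaussian_def by (subst nn_integral_density) auto

text \<open>
  The density of two independent standard Gaussians depends on \<open>x\<^sup>2 + y\<^sup>2\<close> only, which the
  reflection with unit vector \<open>(a, b) / r\<close> preserves, and \<open>a * x + b * y\<close> is \<open>r\<close> times the first coordinate
  of the reflected point.
\<close>

lemma gaussian_plane_rotation:
  fixes F :: "real \<Rightarrow> real \<Rightarrow> ennreal"
  assumes F [measurable]: "case_prod F \<in> borel_measurable (borel \<Otimes>\<^sub>M borel)"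
  shows "(\<integral>\<^sup>+ x. \<integral>\<^sup>+ y. F (a * x + b * y) (x\<^sup>2 + y\<^sup>2) \<partial>std_gaussian \<partial>std_gaussian)
    = (\<integral>\<^sup>+ x. \<integral>\<^sup>+ y. F (sqrt (a\<^sup>2 + b\<^sup>2) * x) (x\<^sup>2 + y\<^sup>2) \<partial>std_gaussian \<partial>std_gaussian)"
proof (cases "a\<^sup>2 + b\<^sup>2 = 0")
  case True
  then have "a = 0" "b = 0" by (auto simp: sum_power2_eq_zero_iff)
  then show ?thesis by simp
next
  case False
  define r where "r = sqrt (a\<^sup>2 + b\<^sup>2)"
  have r: "r > 0" "r\<^sup>2 = a\<^sup>2 + b\<^sup>2"
    using False by (auto simp: r_def less_le sum_power2_eq_zero_iff)
  define w where "w p q = ennreal (exp (- (p\<^sup>2 + q\<^sup>2) / 2) / (2 * pi))" for p q :: real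
  have w: "ennreal (std_normal_density x) * ennreal (std_normal_density y) = w x y" for x y
  proof -
    have "std_normal_density x * std_normal_density y
        = (exp (- (x\<^sup>2) / 2) * exp (- (y\<^sup>2) / 2)) / (sqrt (2 * pi) * sqrt (2 * pi))"
      by (simp add: std_normal_density_def)
    also have "\<dots> = exp (- (x\<^sup>2 + y\<^sup>2) / 2) / (2 * pi)"
      unfolding exp_add[symmetric] by (simp add: add_divide_distrib)
    finally show ?thesis by (simp add: w_def ennreal_mult'[symmetric])
  qed
  have gg: "(\<integral>\<^sup>+ x. \<integral>\<^sup>+ y. G x y \<partial>std_gaussian \<partial>std_gaussian)
      = (\<integral>\<^sup>+ x. \<integral>\<^sup>+ y. w x y * G x y \<partial>lborel \<partial>lborel)"
    if [measurable]: "case_prod G \<in> borel_measurable (borel \<Otimes>\<^sub>M borel)" for G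
    by (simp add: nn_integral_std_gaussian nn_integral_cmult[symmetric] mult.assoc[symmetric] w)
  have unit: "(a / r)\<^sup>2 + (b / r)\<^sup>2 = 1"
    unfolding power_divide add_divide_distrib[symmetric] r(2)[symmetric] using r(1) by simp
  let ?h = "\<lambda>p q. w p q * F (r * p) (p\<^sup>2 + q\<^sup>2)"
  have iso: "(a / r * x + b / r * y)\<^sup>2 + (b / r * x - a / r * y)\<^sup>2 = x\<^sup>2 + y\<^sup>2" for x y
  proof -
    have "(p * x + q * y)\<^sup>2 + (q * x - p * y)\<^sup>2 = (p\<^sup>2 + q\<^sup>2) * (x\<^sup>2 + y\<^sup>2)" for p q
      by (simp add: power2_eq_square algebra_simps)
    from this[of "a / r" "b / r"] show ?thesis by (simp add: unit)
  qed
  have lin: "r * (a / r * x + b / r * y) = a * x + b * y" for x y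
    using r by (simp add: field_simps)
  have [measurable]: "case_prod w \<in> borel_measurable (borel \<Otimes>\<^sub>M borel)"
    unfolding w_def by measurable
  have "(\<integral>\<^sup>+ x. \<integral>\<^sup>+ y. F (a * x + b * y) (x\<^sup>2 + y\<^sup>2) \<partial>std_gaussian \<partial>std_gaussian)
      = (\<integral>\<^sup>+ x. \<integral>\<^sup>+ y. w x y * F (a * x + b * y) (x\<^sup>2 + y\<^sup>2) \<partial>lborel \<partial>lborel)"
    by (rule gg) simp
  also have "\<dots> = (\<integral>\<^sup>+ x. \<integral>\<^sup>+ y. ?h (a / r * x + b / r * y) (b / r * x - a / r * y) \<partial>lborel \<partial>lborel)"
    unfolding w_def iso lin ..
  also have "\<dots> = (\<integral>\<^sup>+ x. \<integral>\<^sup>+ y. ?h x y \<partial>lborel \<partial>lborel)"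
    by (rule lebesgue_plane_reflection) (use unit in auto)
  also have "\<dots> = (\<integral>\<^sup>+ x. \<integral>\<^sup>+ y. F (r * x) (x\<^sup>2 + y\<^sup>2) \<partial>std_gaussian \<partial>std_gaussian)"
    by (rule gg[symmetric]) simp
  finally show ?thesis by (simp add: r_def)
qed

lemma nn_integral_std_gaussian_uminus:
  assumes [measurable]: "f \<in> borel_measurable borel"
  shows "(\<integral>\<^sup>+ x. f (- x) \<partial>std_gaussian) = (\<integral>\<^sup>+ x. f x \<partial>std_gaussian)"
  unfolding nn_integral_std_gaussian[OF assms]
  by (subst nn_integral_real_affine[where c="-1" and t=0])
     (auto simp: nn_integral_std_gaussian std_normal_density_def)

text \<open>
  The right-hand side depends on \<open>\<theta>\<close> only through its norm: this is the part of the rotation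
  invariance of the Gaussian vector that is needed below.  Adding a coordinate, the induction
  hypothesis replaces the old coordinates by a single Gaussian variable with weight \<open>r\<close>, and a rotation
  in the plane merges it with the new one.
\<close>

lemma gaussian_projection_norm_law:
  fixes F :: "real \<Rightarrow> real \<Rightarrow> ennreal"
  assumes J: "finite J" "j \<notin> J"
    and F: "case_prod F \<in> borel_measurable (borel \<Otimes>\<^sub>M borel)"
  shows "(\<integral>\<^sup>+ g. F (\<Sum>i\<in>insert j J. \<theta> i * g i) (\<Sum>i\<in>insert j J. (g i)\<^sup>2) \<partial>gaussian_vector (insert j J))
    = (\<integral>\<^sup>+ x. \<integral>\<^sup>+ g. F (sqrt (\<Sum>i\<in>insert j J. (\<theta> i)\<^sup>2) * x) (x\<^sup>2 + (\<Sum>i\<in>J. (g i)\<^sup>2))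
        \<partial>gaussian_vector J \<partial>std_gaussian)"
  using J F
proof (induction J arbitrary: F rule: finite_induct)
  case empty
  note [measurable] = empty(2)
  have "(\<integral>\<^sup>+ x. F (\<theta> j * x) (x\<^sup>2) \<partial>std_gaussian) = (\<integral>\<^sup>+ x. F (\<bar>\<theta> j\<bar> * x) (x\<^sup>2) \<partial>std_gaussian)"
    using nn_integral_std_gaussian_uminus[of "\<lambda>x. F (\<theta> j * x) (x\<^sup>2)"]
    by (cases "\<theta> j \<ge> 0") auto
  then show ?case
    by (simp add: gaussian_product.nn_integral_empty prob_space.emeasure_space_1[OF prob_space_gaussian_vector]
        gaussian_product.product_nn_integral_singleton[where i=j and f="\<lambda>x. F (\<theta> j * x) (x\<^sup>2)"])
next
  case (insert i J)
  note [measurable] = insert.prems(2)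
  have ij: "i \<noteq> j" "j \<notin> J" and fin: "finite (insert j J)" and iJ: "i \<notin> insert j J"
    using insert by auto
  let ?r = "sqrt (\<Sum>k\<in>insert j J. (\<theta> k)\<^sup>2)"
  have sq: "(\<Sum>k\<in>insert j J. (\<theta> k)\<^sup>2) \<ge> 0" by (intro sum_nonneg) auto
  have upd: "(\<Sum>k\<in>insert i K. h k ((g(i := y)) k)) = h i y + (\<Sum>k\<in>K. h k (g k))"
    if "finite K" "i \<notin> K" for K y g and h :: "nat \<Rightarrow> real \<Rightarrow> real"
    using that by (auto intro!: sum.cong)
  \<comment> \<open>The remaining coordinates are integrated out, which leaves a function for the plane rotation.\<close>
  define F2 where "F2 p s = (\<integral>\<^sup>+ g. F p (s + (\<Sum>k\<in>J. (g k)\<^sup>2)) \<partial>gaussian_vector J)" for p s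
  have [measurable]: "case_prod F2 \<in> borel_measurable (borel \<Otimes>\<^sub>M borel)"
    unfolding F2_def by measurable
  have "(\<integral>\<^sup>+ g. F (\<Sum>k\<in>insert j (insert i J). \<theta> k * g k) (\<Sum>k\<in>insert j (insert i J). (g k)\<^sup>2)
        \<partial>gaussian_vector (insert j (insert i J)))
    = (\<integral>\<^sup>+ g. F (\<Sum>k\<in>insert i (insert j J). \<theta> k * g k) (\<Sum>k\<in>insert i (insert j J). (g k)\<^sup>2)
        \<partial>gaussian_vector (insert i (insert j J)))"
    by (simp only: insert_commute)
  also have "\<dots> = (\<integral>\<^sup>+ y. \<integral>\<^sup>+ g. F (\<theta> i * y + (\<Sum>k\<in>insert j J. \<theta> k * g k))
        (y\<^sup>2 + (\<Sum>k\<in>insert j J. (g k)\<^sup>2)) \<partial>gaussian_vector (insert j J) \<partial>std_gaussian)"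
    by (subst gaussian_product.product_nn_integral_insert_rev[OF fin iJ])
       (simp_all only: upd[OF fin iJ, of "\<lambda>k x. \<theta> k * x"] upd[OF fin iJ, of "\<lambda>k x. x\<^sup>2"], measurable)
  also have "\<dots> = (\<integral>\<^sup>+ y. \<integral>\<^sup>+ x. \<integral>\<^sup>+ g. F (\<theta> i * y + ?r * x)
        (y\<^sup>2 + (x\<^sup>2 + (\<Sum>k\<in>J. (g k)\<^sup>2))) \<partial>gaussian_vector J \<partial>std_gaussian \<partial>std_gaussian)"
  proof (rule nn_integral_cong)
    fix y
    show "(\<integral>\<^sup>+ g. F (\<theta> i * y + (\<Sum>k\<in>insert j J. \<theta> k * g k))
        (y\<^sup>2 + (\<Sum>k\<in>insert j J. (g k)\<^sup>2)) \<partial>gaussian_vector (insert j J))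
      = (\<integral>\<^sup>+ x. \<integral>\<^sup>+ g. F (\<theta> i * y + ?r * x)
        (y\<^sup>2 + (x\<^sup>2 + (\<Sum>k\<in>J. (g k)\<^sup>2))) \<partial>gaussian_vector J \<partial>std_gaussian)"
      by (rule insert.IH[of "\<lambda>p s. F (\<theta> i * y + p) (y\<^sup>2 + s)"]) (use ij in auto)
  qed
  also have "\<dots> = (\<integral>\<^sup>+ y. \<integral>\<^sup>+ x. F2 (\<theta> i * y + ?r * x) (y\<^sup>2 + x\<^sup>2) \<partial>std_gaussian \<partial>std_gaussian)"
    by (simp add: F2_def add.assoc)
  also have "\<dots> = (\<integral>\<^sup>+ x. \<integral>\<^sup>+ y. F2 (sqrt ((\<theta> i)\<^sup>2 + ?r\<^sup>2) * x) (x\<^sup>2 + y\<^sup>2) \<partial>std_gaussian \<partial>std_gaussian)"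
    by (rule gaussian_plane_rotation) simp
  also have "(\<theta> i)\<^sup>2 + ?r\<^sup>2 = (\<Sum>k\<in>insert j (insert i J). (\<theta> k)\<^sup>2)"
    using sq fin iJ ij insert.hyps by (simp add: insert_commute)
  also have "(\<integral>\<^sup>+ x. \<integral>\<^sup>+ y. F2 (sqrt (\<Sum>k\<in>insert j (insert i J). (\<theta> k)\<^sup>2) * x) (x\<^sup>2 + y\<^sup>2)
        \<partial>std_gaussian \<partial>std_gaussian)
    = (\<integral>\<^sup>+ x. \<integral>\<^sup>+ g. F (sqrt (\<Sum>k\<in>insert j (insert i J). (\<theta> k)\<^sup>2) * x) (x\<^sup>2 + (\<Sum>k\<in>insert i J. (g k)\<^sup>2))
        \<partial>gaussian_vector (insert i J) \<partial>std_gaussian)"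
  proof (rule nn_integral_cong)
    fix x
    let ?R = "sqrt (\<Sum>k\<in>insert j (insert i J). (\<theta> k)\<^sup>2)"
    show "(\<integral>\<^sup>+ y. F2 (?R * x) (x\<^sup>2 + y\<^sup>2) \<partial>std_gaussian)
      = (\<integral>\<^sup>+ g. F (?R * x) (x\<^sup>2 + (\<Sum>k\<in>insert i J. (g k)\<^sup>2)) \<partial>gaussian_vector (insert i J))"
      unfolding F2_def
      by (subst gaussian_product.product_nn_integral_insert_rev[OF insert.hyps])
         (simp_all only: upd[OF insert.hyps, of "\<lambda>k x. x\<^sup>2"] add.assoc, measurable)
  qed
  finally show ?case .
qed

text \<open>
  The Gaussian density is positive everywhere.
\<close>

lemma std_gaussian_pos:
  assumes "A \<in> sets borel" "emeasure lborel A \<noteq> 0"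
  shows "emeasure std_gaussian A > 0"
proof -
  have "AE x in lborel. x \<notin> A" if "emeasure std_gaussian A = 0"
  proof -
    have "(\<integral>\<^sup>+ x. ennreal (std_normal_density x) * indicator A x \<partial>lborel) = 0"
      using that assms unfolding std_gaussian_def by (simp add: emeasure_density)
    then have "AE x in lborel. ennreal (std_normal_density x) * indicator A x = 0"
      using assms by (subst (asm) nn_integral_0_iff_AE) auto
    moreover have "\<not> std_normal_density x \<le> 0" for x
      using normal_density_pos[of 1 0 x] by simp
    ultimately show ?thesis
      by (elim eventually_mono) (auto simp: indicator_def ennreal_eq_0_iff)
  qed
  then show ?thesis using assms
    by (auto simp: AE_iff_measurable[OF _ refl] zero_less_iff_neq_zero)
qed

lemma integral_std_gaussian:
  fixes f :: "real \<Rightarrow> real"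
  assumes "f \<in> borel_measurable borel"
  shows "(\<integral>x. f x \<partial>std_gaussian) = (\<integral>x. std_normal_density x * f x \<partial>lborel)"
  unfolding std_gaussian_def using assms by (subst integral_density) auto

lemma integrable_std_gaussian:
  fixes f :: "real \<Rightarrow> real"
  assumes "f \<in> borel_measurable borel"
  shows "integrable std_gaussian f \<longleftrightarrow> integrable lborel (\<lambda>x. std_normal_density x * f x)"
  unfolding std_gaussian_def using assms by (subst integrable_density) auto

section \<open>Rotation invariant measures on the sphere\<close>

text \<open>
  For a unit vector \<open>\<theta>\<close>, this says that the cosine of the angle between \<open>\<theta>\<close> and \<open>g\<close> exceeds \<open>\<kappa>\<close>; the
  form without division excludes \<open>g = 0\<close>.
\<close>

definition cone :: "nat \<Rightarrow> real \<Rightarrow> (nat \<Rightarrow> real) \<Rightarrow> (nat \<Rightarrow> real) \<Rightarrow> bool" where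
  "cone n \<kappa> \<theta> g \<longleftrightarrow> \<kappa> * sqrt (\<Sum>i=1..n. (g i)\<^sup>2) < (\<Sum>i=1..n. \<theta> i * g i)"

lemma unit_sphere_iff:
  "x \<in> unit_sphere n \<longleftrightarrow> x \<in> {1..n} \<rightarrow>\<^sub>E UNIV \<and> (\<Sum>i=1..n. (x i)\<^sup>2) = 1"
  by (auto simp: unit_sphere_def)

lemma space_sphere_borel: "space (sphere_borel n) = unit_sphere n"
  by (auto simp: sphere_borel_def space_restrict_space unit_sphere_def space_PiM)

lemma sets_gaussian_vector [measurable_cong]:
  "sets (gaussian_vector J) = sets (\<Pi>\<^sub>M i\<in>J. borel)"
  by (rule sets_PiM_cong) auto

lemma gaussian_vector_component:
  "i \<in> J \<Longrightarrow> (\<lambda>g. g i) \<in> borel_measurable (gaussian_vector J)"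
  using measurable_component_singleton[of i J "\<lambda>_. std_gaussian"]
  by (simp cong: measurable_cong_sets)

lemma measurable_sphere_component:
  "i \<in> {1..n} \<Longrightarrow> (\<lambda>\<theta>. \<theta> i) \<in> borel_measurable (sphere_borel n)"
  unfolding sphere_borel_def by (rule measurable_restrict_space1) simp

lemma gaussian_cone_const:
  assumes n: "n \<ge> 1" and u: "(\<Sum>i=1..n. (\<theta> i)\<^sup>2) = 1" "(\<Sum>i=1..n. (\<eta> i)\<^sup>2) = 1"
  shows "(\<integral>\<^sup>+ g. indicator {g. cone n \<kappa> \<theta> g} g \<partial>gaussian_vector {1..n})
    = (\<integral>\<^sup>+ g. indicator {g. cone n \<kappa> \<eta> g} g \<partial>gaussian_vector {1..n})"
proof -
  define F :: "real \<Rightarrow> real \<Rightarrow> ennreal" where "F p s = indicator {0<..} (p - \<kappa> * sqrt s)" for p s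
  have F: "case_prod F \<in> borel_measurable (borel \<Otimes>\<^sub>M borel)"
    unfolding F_def by measurable
  have I: "insert 1 {2..n} = {1..n}" using n by auto
  have "(\<integral>\<^sup>+ g. indicator {g. cone n \<kappa> \<theta> g} g \<partial>gaussian_vector {1..n})
    = (\<integral>\<^sup>+ x. \<integral>\<^sup>+ g. F x (x\<^sup>2 + (\<Sum>i=2..n. (g i)\<^sup>2)) \<partial>gaussian_vector {2..n} \<partial>std_gaussian)"
    if "(\<Sum>i=1..n. (\<theta> i)\<^sup>2) = 1" for \<theta>
  proof -
    have "indicator {g. cone n \<kappa> \<theta> g} g = F (\<Sum>i=1..n. \<theta> i * g i) (\<Sum>i=1..n. (g i)\<^sup>2)" for g
      by (auto simp: F_def cone_def indicator_def)
    then show ?thesis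
      using gaussian_projection_norm_law[of "{2..n}" 1 F \<theta>] F that unfolding I by simp
  qed
  from this[OF u(1)] this[OF u(2)] show ?thesis by simp
qed

text \<open>
  By \<open>gaussian_cone_const\<close> one may take the first unit vector.  A box in which the first coordinate
  is large and all others are less than one in absolute value lies in its cone.
\<close>

lemma gaussian_cone_pos:
  assumes n: "n \<ge> 1" and u: "(\<Sum>i=1..n. (\<theta> i)\<^sup>2) = 1" and k: "0 \<le> \<kappa>" "\<kappa> < 1"
  shows "(\<integral>\<^sup>+ g. indicator {g. cone n \<kappa> \<theta> g} g \<partial>gaussian_vector {1..n}) > 0"
proof -
  define e where "e = (\<lambda>i::nat. if i = 1 then 1 else 0 :: real)"
  have e: "(\<Sum>i=1..n. (e i)\<^sup>2) = 1" "(\<Sum>i=1..n. e i * g i) = g 1" for g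
    using n by (auto simp: e_def if_distrib[of "\<lambda>x. x\<^sup>2"] if_distrib[of "\<lambda>x. x * _"] cong: if_cong)
  define \<delta> where "\<delta> = 1 - \<kappa>\<^sup>2"
  have \<delta>: "\<delta> > 0" using k by (simp add: \<delta>_def power_less_one_iff)
  \<comment> \<open>This makes \<open>(1 - \<kappa>\<^sup>2) * a\<^sup>2 > n\<close>, more than the other coordinates can contribute.\<close>
  define a where "a = sqrt (real n / \<delta>) + 1"
  define B where "B i = (if i = 1 then {a<..<a + 1} else {-1<..<1::real})" for i :: nat
  define S where "S = (\<Pi>\<^sub>E i\<in>{1..n}. B i)"
  have "cone n \<kappa> e g" if g: "g \<in> S" for g
  proof -
    have g1: "g 1 > a" using g n by (auto simp: S_def B_def PiE_def Pi_def split: if_splits)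
    have a0: "a > 0" unfolding a_def using \<delta> by (intro add_nonneg_pos) auto
    have "real n / \<delta> = (sqrt (real n / \<delta>))\<^sup>2" using \<delta> by simp
    also have "\<dots> < (g 1)\<^sup>2"
      using g1 \<delta> by (intro power_strict_mono) (auto simp: a_def)
    finally have "real n < \<delta> * (g 1)\<^sup>2" using \<delta> by (simp add: field_simps)
    moreover have "(\<Sum>i=2..n. (g i)\<^sup>2) \<le> (\<Sum>i=2..n. 1)"
    proof (rule sum_mono)
      fix i assume "i \<in> {2..n}"
      then have "g i \<in> {-1<..<1}" using g by (auto simp: S_def B_def PiE_def Pi_def split: if_splits)
      then show "(g i)\<^sup>2 \<le> 1" by (auto simp: abs_square_le_1)
    qed
    ultimately have "(\<Sum>i=2..n. (g i)\<^sup>2) < \<delta> * (g 1)\<^sup>2" using n by simp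
    moreover have "(\<Sum>i=1..n. (g i)\<^sup>2) = (g 1)\<^sup>2 + (\<Sum>i=2..n. (g i)\<^sup>2)"
      using n by (subst sum.atLeast_Suc_atMost) (auto simp: numeral_2_eq_2)
    moreover have "\<kappa>\<^sup>2 * (\<Sum>i=2..n. (g i)\<^sup>2) \<le> 1 * (\<Sum>i=2..n. (g i)\<^sup>2)"
      using k by (intro mult_right_mono sum_nonneg) (auto simp: power_le_one)
    ultimately have "\<kappa>\<^sup>2 * (\<Sum>i=1..n. (g i)\<^sup>2) < (g 1)\<^sup>2"
      by (simp add: \<delta>_def algebra_simps)
    then have "sqrt (\<kappa>\<^sup>2 * (\<Sum>i=1..n. (g i)\<^sup>2)) < sqrt ((g 1)\<^sup>2)" by (rule real_sqrt_less_mono)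
    then show ?thesis using g1 a0 k unfolding cone_def e by (simp add: real_sqrt_mult)
  qed
  then have le: "indicator S g \<le> (indicator {g. cone n \<kappa> e g} g :: ennreal)" for g
    by (auto simp: indicator_def)
  have "0 < (\<Prod>i=1..n. emeasure std_gaussian (B i))"
  proof -
    have "emeasure std_gaussian (B i) \<noteq> 0" for i
      using std_gaussian_pos[of "B i"] by (auto simp: B_def)
    then show ?thesis by (simp add: zero_less_iff_neq_zero prod_zero_iff)
  qed
  also have "\<dots> = emeasure (gaussian_vector {1..n}) S"
    unfolding S_def by (rule gaussian_product.emeasure_PiM[symmetric]) (auto simp: B_def)
  also have "\<dots> = (\<integral>\<^sup>+ g. indicator S g \<partial>gaussian_vector {1..n})"
    unfolding S_def by (rule nn_integral_indicator[symmetric]) (auto intro!: sets_PiM_I_finite simp: B_def)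
  also have "\<dots> \<le> (\<integral>\<^sup>+ g. indicator {g. cone n \<kappa> e g} g \<partial>gaussian_vector {1..n})"
    by (intro nn_integral_mono le)
  also have "\<dots> = (\<integral>\<^sup>+ g. indicator {g. cone n \<kappa> \<theta> g} g \<partial>gaussian_vector {1..n})"
    using n e(1) u by (rule gaussian_cone_const)
  finally show ?thesis .
qed

lemma orthogonal_mat_norm:
  assumes "orthogonal_mat n A"
  shows "(\<Sum>i=1..n. (\<Sum>j=1..n. A i j * x j)\<^sup>2) = (\<Sum>j=1..n. (x j)\<^sup>2)"
proof -
  have "(\<Sum>i=1..n. (\<Sum>j=1..n. A i j * x j)\<^sup>2)
    = (\<Sum>i=1..n. \<Sum>j=1..n. \<Sum>k=1..n. (x j * x k) * (A i j * A i k))"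
    by (simp add: power2_eq_square sum_product ac_simps)
  also have "\<dots> = (\<Sum>j=1..n. \<Sum>i=1..n. \<Sum>k=1..n. (x j * x k) * (A i j * A i k))"
    by (rule sum.swap)
  also have "\<dots> = (\<Sum>j=1..n. \<Sum>k=1..n. \<Sum>i=1..n. (x j * x k) * (A i j * A i k))"
    by (intro sum.cong refl sum.swap)
  also have "\<dots> = (\<Sum>j=1..n. \<Sum>k=1..n. (x j * x k) * (\<Sum>i=1..n. A i j * A i k))"
    by (simp add: sum_distrib_left)
  also have "\<dots> = (\<Sum>j=1..n. \<Sum>k=1..n. (x j * x k) * (if j = k then 1 else 0))"
    using assms unfolding orthogonal_mat_def by (intro sum.cong refl) auto
  also have "\<dots> = (\<Sum>j=1..n. (x j)\<^sup>2)"
    by (simp add: if_distrib[of "\<lambda>x. _ * x"] power2_eq_square cong: if_cong)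
  finally show ?thesis .
qed

lemma mat_apply_measurable:
  assumes "orthogonal_mat n A"
  shows "mat_apply n A \<in> measurable (sphere_borel n) (sphere_borel n)"
proof -
  have "mat_apply n A \<in> measurable (sphere_borel n) (restrict_space (\<Pi>\<^sub>M i\<in>{1..n}. borel) (unit_sphere n))"
  proof (rule measurable_restrict_space2)
    note [measurable] = measurable_sphere_component
    show "mat_apply n A \<in> space (sphere_borel n) \<rightarrow> unit_sphere n"
      using orthogonal_mat_norm[OF assms]
      by (auto simp: space_sphere_borel unit_sphere_iff mat_apply_def)
    show "mat_apply n A \<in> measurable (sphere_borel n) (\<Pi>\<^sub>M i\<in>{1..n}. borel)"
      unfolding mat_apply_def by (intro measurable_restrict) measurable
  qed
  then show ?thesis by (simp add: sphere_borel_def)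
qed

text \<open>
  The Householder reflection that exchanges \<open>\<eta>\<close> and \<open>\<zeta>\<close>.  If \<open>\<eta> = \<zeta>\<close>, then \<open>q = 0\<close> and division by
  zero gives \<open>c = 0\<close>, so the formula yields the identity matrix.
\<close>

lemma orthogonal_mat_transitive:
  assumes u: "(\<Sum>i=1..n. (\<eta> i)\<^sup>2) = 1" "(\<Sum>i=1..n. (\<zeta> i)\<^sup>2) = 1"
  obtains A where "orthogonal_mat n A"
    "\<And>x. (\<Sum>i=1..n. mat_apply n A x i * \<eta> i) = (\<Sum>i=1..n. x i * \<zeta> i)"
proof
  define w where "w i = \<eta> i - \<zeta> i" for i
  define q where "q = (\<Sum>i=1..n. (w i)\<^sup>2)"
  define c where "c = 2 / q"
  define A where "A i j = (if i = j then 1 else 0) - c * w i * w j" for i j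
  have cq: "c * c * q = 2 * c" by (simp add: c_def)
  show "orthogonal_mat n A"
    unfolding orthogonal_mat_def
  proof (intro ballI)
    fix i j assume ij: "i \<in> {1..n}" "j \<in> {1..n}"
    have "(\<Sum>k=1..n. A k i * A k j) = (\<Sum>k=1..n. (if k = i then (if k = j then 1 else 0) else 0)
        - (if k = i then c * w k * w j else 0) - (if k = j then c * w k * w i else 0)
        + c * c * w i * w j * (w k)\<^sup>2)"
      by (intro sum.cong refl) (auto simp: A_def power2_eq_square algebra_simps)
    also have "\<dots> = (if i = j then 1 else 0) - c * w i * w j - c * w j * w i + c * c * w i * w j * q"
      using ij by (simp add: sum.distrib sum_subtractf sum_distrib_left[symmetric] q_def)
    also have "c * c * w i * w j * q = 2 * c * w i * w j"
      using cq by (metis (no_types, opaque_lifting) mult.assoc mult.commute)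
    finally show "(\<Sum>k=1..n. A k i * A k j) = (if i = j then 1 else 0)" by simp
  qed
  define s where "s = (\<Sum>i=1..n. \<eta> i * \<zeta> i)"
  have q: "q = 2 - 2 * s"
    using u by (simp add: q_def w_def s_def power2_diff sum.distrib sum_subtractf sum_distrib_left mult.assoc)
  have w\<eta>: "(\<Sum>i=1..n. w i * \<eta> i) = 1 - s"
  proof -
    have "(\<Sum>i=1..n. w i * \<eta> i) = (\<Sum>i=1..n. (\<eta> i)\<^sup>2 - \<eta> i * \<zeta> i)"
      by (intro sum.cong refl) (simp add: w_def power2_eq_square algebra_simps)
    then show ?thesis by (simp only: sum_subtractf u s_def)
  qed
  have cw: "c * (1 - s) * w j = w j" if "j \<in> {1..n}" for j
  proof (cases "q = 0")
    case True
    then have "(w j)\<^sup>2 = 0" using that unfolding q_def by (subst (asm) sum_nonneg_eq_0_iff) auto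
    then show ?thesis by simp
  next
    case False
    have "c * (1 - s) = 1" using False q by (simp add: c_def field_simps)
    then show ?thesis by simp
  qed
  have A\<eta>: "(\<Sum>i=1..n. A i j * \<eta> i) = \<zeta> j" if j: "j \<in> {1..n}" for j
  proof -
    have "(\<Sum>i=1..n. A i j * \<eta> i) = (\<Sum>i=1..n. (if i = j then \<eta> i else 0) - c * w j * (w i * \<eta> i))"
      by (intro sum.cong refl) (auto simp: A_def algebra_simps)
    also have "\<dots> = \<eta> j - c * w j * (1 - s)"
      using j by (simp add: sum_subtractf sum_distrib_left[symmetric] w\<eta> del: One_nat_def)
    also have "c * w j * (1 - s) = w j" using cw[OF j] by (simp add: ac_simps)
    finally show ?thesis by (simp add: w_def)
  qed
  fix x
  have "(\<Sum>i=1..n. mat_apply n A x i * \<eta> i) = (\<Sum>i=1..n. \<Sum>j=1..n. x j * (A i j * \<eta> i))"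
    by (simp add: mat_apply_def sum_distrib_left sum_distrib_right ac_simps)
  also have "\<dots> = (\<Sum>j=1..n. \<Sum>i=1..n. x j * (A i j * \<eta> i))" by (rule sum.swap)
  also have "\<dots> = (\<Sum>j=1..n. x j * \<zeta> j)"
    using A\<eta> by (simp add: sum_distrib_left[symmetric])
  finally show "(\<Sum>i=1..n. mat_apply n A x i * \<eta> i) = (\<Sum>i=1..n. x i * \<zeta> i)" .
qed

lemma cap_measure_const:
  assumes M: "rotation_invariant_prob n M"
    and u: "(\<Sum>i=1..n. (\<eta> i)\<^sup>2) = 1" "(\<Sum>i=1..n. (\<zeta> i)\<^sup>2) = 1"
  shows "emeasure M {\<theta>\<in>space M. \<kappa> < (\<Sum>i=1..n. \<theta> i * \<eta> i)}
    = emeasure M {\<theta>\<in>space M. \<kappa> < (\<Sum>i=1..n. \<theta> i * \<zeta> i)}"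
proof -
  have sM [measurable_cong]: "sets M = sets (sphere_borel n)"
    and inv: "\<And>A. orthogonal_mat n A \<Longrightarrow> distr M (sphere_borel n) (mat_apply n A) = M"
    using M by (auto simp: rotation_invariant_prob_def)
  note [measurable] = measurable_sphere_component
  have space: "space M = space (sphere_borel n)" using sM by (rule sets_eq_imp_space_eq)
  obtain A where A: "orthogonal_mat n A"
    "\<And>x. (\<Sum>i=1..n. mat_apply n A x i * \<eta> i) = (\<Sum>i=1..n. x i * \<zeta> i)"
    using orthogonal_mat_transitive[OF u] by blast
  have [measurable]: "mat_apply n A \<in> measurable M (sphere_borel n)"
    using mat_apply_measurable[OF A(1)] by (simp add: measurable_cong_sets[OF sM refl])
  let ?C = "{\<theta>\<in>space (sphere_borel n). \<kappa> < (\<Sum>i=1..n. \<theta> i * \<eta> i)}"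
  have C: "?C \<in> sets (sphere_borel n)" by measurable
  have "emeasure M ?C = emeasure (distr M (sphere_borel n) (mat_apply n A)) ?C"
    using inv[OF A(1)] by simp
  also have "\<dots> = emeasure M (mat_apply n A -` ?C \<inter> space M)"
    using C by (rule emeasure_distr[rotated]) simp
  also have "mat_apply n A -` ?C \<inter> space M = {\<theta>\<in>space M. \<kappa> < (\<Sum>i=1..n. \<theta> i * \<zeta> i)}"
    using A(2) measurable_space[of "mat_apply n A" M "sphere_borel n"] by auto
  finally show ?thesis by (simp add: space)
qed

text \<open>
  Consider the kernel \<open>K \<theta> g\<close> that indicates a small angle between \<open>\<theta>\<close> and \<open>g\<close>.  Integrated over
  the Gaussian \<open>g\<close> it gives the same \<open>c > 0\<close> for every \<open>\<theta>\<close>, and integrated over \<open>\<theta>\<close> under \<open>M\<close> it gives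
  the same \<open>d\<close> for every \<open>g \<noteq> 0\<close>; by Fubini's theorem \<open>c = d\<close>.  If \<open>\<theta> \<in> B\<close> and \<open>K \<theta> g = 1\<close>, then
  \<open>g \<in> B'\<close>, so \<open>c * M B\<close>, the mass of the kernel over \<open>\<theta> \<in> B\<close>, is at most \<open>c\<close> times the Gaussian
  measure of \<open>B'\<close>.
\<close>

lemma sphere_measure_le_gaussian:
  assumes n: "n \<ge> 1" and M: "rotation_invariant_prob n M"
    and B: "B \<in> sets M" and B': "B' \<in> sets (gaussian_vector {1..n})"
    and \<kappa>: "0 \<le> \<kappa>" "\<kappa> < 1"
    and sub: "\<And>\<theta> g. \<theta> \<in> B \<Longrightarrow> g \<in> space (gaussian_vector {1..n}) \<Longrightarrow> cone n \<kappa> \<theta> g \<Longrightarrow> g \<in> B'"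
  shows "emeasure M B \<le> emeasure (gaussian_vector {1..n}) B'"
proof -
  let ?N = "gaussian_vector {1..n}"
  interpret M: prob_space M using M by (simp add: rotation_invariant_prob_def)
  interpret N: prob_space ?N by (rule prob_space_gaussian_vector)
  interpret MN: pair_sigma_finite M ?N ..
  have sM [measurable_cong]: "sets M = sets (sphere_borel n)"
    using M by (auto simp: rotation_invariant_prob_def)
  have space: "space M = unit_sphere n"
    using sets_eq_imp_space_eq[OF sM] by (simp add: space_sphere_borel)
  have M_component [measurable]: "(\<lambda>\<theta>. \<theta> i) \<in> borel_measurable M" if "i \<in> {1..n}" for i
    using measurable_sphere_component[OF that] by (simp add: measurable_cong_sets[OF sM refl])
  have unit: "(\<Sum>i=1..n. (\<theta> i)\<^sup>2) = 1" if "\<theta> \<in> space M" for \<theta>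
    using that by (simp add: space unit_sphere_iff)
  obtain \<theta>0 where \<theta>0: "\<theta>0 \<in> space M" using M.not_empty by blast
  define K :: "(nat \<Rightarrow> real) \<Rightarrow> (nat \<Rightarrow> real) \<Rightarrow> ennreal" where "K \<theta> g = indicator {g. cone n \<kappa> \<theta> g} g" for \<theta> g
  have K [measurable]: "case_prod K \<in> borel_measurable (M \<Otimes>\<^sub>M ?N)"
  proof -
    have *: "K = (\<lambda>\<theta> g. indicator {0<..} ((\<Sum>i=1..n. \<theta> i * g i) - \<kappa> * sqrt (\<Sum>i=1..n. (g i)\<^sup>2)))"
      by (auto simp: K_def cone_def indicator_def fun_eq_iff)
    have [measurable]: "(\<lambda>z. snd z i) \<in> borel_measurable (M \<Otimes>\<^sub>M ?N)" if "i \<in> {1..n}" for i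
      by (rule measurable_compose[OF measurable_snd gaussian_vector_component[OF that]])
    have [measurable]: "(\<lambda>z. fst z i) \<in> borel_measurable (M \<Otimes>\<^sub>M ?N)" if "i \<in> {1..n}" for i
      by (rule measurable_compose[OF measurable_fst M_component[OF that]])
    show ?thesis unfolding * split_beta' by measurable
  qed
  define c where "c = (\<integral>\<^sup>+ g. K \<theta>0 g \<partial>?N)"
  define d where "d = emeasure M {\<theta>\<in>space M. \<kappa> < (\<Sum>i=1..n. \<theta> i * \<theta>0 i)}"
  have c: "(\<integral>\<^sup>+ g. K \<theta> g \<partial>?N) = c" if "\<theta> \<in> space M" for \<theta>
    unfolding c_def K_def by (rule gaussian_cone_const[OF n]) (use that \<theta>0 unit in auto)
  have c_pos: "c > 0" unfolding c_def K_def by (rule gaussian_cone_pos[OF n unit[OF \<theta>0] \<kappa>])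
  have c_fin: "c \<le> 1"
  proof -
    have "c \<le> (\<integral>\<^sup>+ g. 1 \<partial>?N)" unfolding c_def K_def by (intro nn_integral_mono) (auto simp: indicator_def)
    then show ?thesis by (simp add: prob_space.emeasure_space_1[OF prob_space_gaussian_vector])
  qed
  have d: "(\<integral>\<^sup>+ \<theta>. K \<theta> g \<partial>M) = d" if g: "(\<Sum>i=1..n. (g i)\<^sup>2) \<noteq> 0" for g
  proof -
    define r where "r = sqrt (\<Sum>i=1..n. (g i)\<^sup>2)"
    have sq: "(\<Sum>i=1..n. (g i)\<^sup>2) \<ge> 0" by (intro sum_nonneg) auto
    have r: "r > 0" "r\<^sup>2 = (\<Sum>i=1..n. (g i)\<^sup>2)" using g sq by (auto simp: r_def)
    have "(\<integral>\<^sup>+ \<theta>. K \<theta> g \<partial>M) = (\<integral>\<^sup>+ \<theta>. indicator {\<theta>\<in>space M. \<kappa> < (\<Sum>i=1..n. \<theta> i * (g i / r))} \<theta> \<partial>M)"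
    proof (rule nn_integral_cong)
      fix \<theta> assume "\<theta> \<in> space M"
      moreover have "(\<Sum>i=1..n. \<theta> i * (g i / r)) = (\<Sum>i=1..n. \<theta> i * g i) / r"
        by (simp add: sum_divide_distrib)
      moreover have "\<kappa> < (\<Sum>i=1..n. \<theta> i * g i) / r \<longleftrightarrow> \<kappa> * r < (\<Sum>i=1..n. \<theta> i * g i)"
        using r by (simp add: pos_less_divide_eq)
      ultimately show "K \<theta> g = indicator {\<theta>\<in>space M. \<kappa> < (\<Sum>i=1..n. \<theta> i * (g i / r))} \<theta>"
        by (auto simp: K_def cone_def r_def indicator_def)
    qed
    also have "\<dots> = emeasure M {\<theta>\<in>space M. \<kappa> < (\<Sum>i=1..n. \<theta> i * (g i / r))}"
      by (rule nn_integral_indicator) measurable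
    also have "\<dots> = d" unfolding d_def
    proof (rule cap_measure_const[OF M])
      have "(\<Sum>i=1..n. (g i / r)\<^sup>2) = (\<Sum>i=1..n. (g i)\<^sup>2) / r\<^sup>2"
        by (simp add: power_divide sum_divide_distrib)
      then show "(\<Sum>i=1..n. (g i / r)\<^sup>2) = 1" using r g by simp
      show "(\<Sum>i=1..n. (\<theta>0 i)\<^sup>2) = 1" using unit[OF \<theta>0] .
    qed
    finally show ?thesis .
  qed
  \<comment> \<open>The mass \<open>d\<close> is only available for \<open>g \<noteq> 0\<close>.\<close>
  have nonzero: "AE g in ?N. (\<Sum>i=1..n. (g i)\<^sup>2) \<noteq> 0"
  proof -
    have "emeasure std_gaussian {0} = 0"
      unfolding std_gaussian_def by (subst emeasure_density) (auto simp: nn_integral_cmult_indicator intro!: nn_integral_0_iff_AE[THEN iffD2] AE_mp[OF AE_lborel_singleton[of 0] AE_I2])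
    then have "AE x in std_gaussian. x \<noteq> 0" by (intro AE_I[of _ _ "{0}"]) auto
    then have "AE x in distr ?N std_gaussian (\<lambda>g. g 1). x \<noteq> 0"
      using n by (subst gaussian_product.PiM_component) auto
    then have "AE g in ?N. g 1 \<noteq> 0" using n by (subst (asm) AE_distr_iff) auto
    then show ?thesis
    proof eventually_elim
      case (elim g)
      then show ?case using n by (subst sum_nonneg_eq_0_iff) (auto intro!: bexI[of _ 1])
    qed
  qed
  have "c = (\<integral>\<^sup>+ \<theta>. \<integral>\<^sup>+ g. K \<theta> g \<partial>?N \<partial>M)"
    by (simp add: c M.emeasure_space_1 cong: nn_integral_cong)
  also have "\<dots> = (\<integral>\<^sup>+ g. \<integral>\<^sup>+ \<theta>. K \<theta> g \<partial>M \<partial>?N)" by (rule MN.Fubini'[symmetric]) (rule K)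
  also have "\<dots> = (\<integral>\<^sup>+ g. d \<partial>?N)"
    by (rule nn_integral_cong_AE) (use nonzero d in \<open>auto elim: eventually_mono\<close>)
  finally have cd: "c = d" by (simp add: prob_space.emeasure_space_1[OF prob_space_gaussian_vector])
  have "c * emeasure M B = (\<integral>\<^sup>+ \<theta>. c * indicator B \<theta> \<partial>M)"
    using B by (simp add: nn_integral_cmult)
  also have "\<dots> = (\<integral>\<^sup>+ \<theta>. \<integral>\<^sup>+ g. indicator B \<theta> * K \<theta> g \<partial>?N \<partial>M)"
  proof (rule nn_integral_cong)
    fix \<theta> assume \<theta>: "\<theta> \<in> space M"
    note [measurable] = measurable_compose_Pair1[OF \<theta> K, simplified]
    show "c * indicator B \<theta> = (\<integral>\<^sup>+ g. indicator B \<theta> * K \<theta> g \<partial>?N)"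
      using c[OF \<theta>] by (simp add: nn_integral_cmult mult.commute)
  qed
  also have "\<dots> = (\<integral>\<^sup>+ g. \<integral>\<^sup>+ \<theta>. indicator B \<theta> * K \<theta> g \<partial>M \<partial>?N)"
  proof (rule MN.Fubini'[symmetric])
    have 1: "(\<lambda>z. indicator B (fst z) :: ennreal) \<in> borel_measurable (M \<Otimes>\<^sub>M ?N)"
      by (rule measurable_compose[OF measurable_fst borel_measurable_indicator[OF B]])
    show "(\<lambda>(\<theta>, g). indicator B \<theta> * K \<theta> g) \<in> borel_measurable (M \<Otimes>\<^sub>M ?N)"
      using borel_measurable_times_ennreal[OF 1 K] by (simp only: split_beta')
  qed
  also have "\<dots> \<le> (\<integral>\<^sup>+ g. d * indicator B' g \<partial>?N)"
  proof (rule nn_integral_mono_AE, use nonzero AE_space in eventually_elim)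
    case (elim g)
    have "(\<integral>\<^sup>+ \<theta>. indicator B \<theta> * K \<theta> g \<partial>M) \<le> (\<integral>\<^sup>+ \<theta>. indicator B' g * K \<theta> g \<partial>M)"
      using sub[OF _ elim(2)] by (intro nn_integral_mono) (auto simp: K_def indicator_def)
    also have "\<dots> = indicator B' g * d"
      using measurable_compose[OF measurable_Pair2'[OF elim(2)] K]
      by (subst nn_integral_cmult) (auto simp: d[OF elim(1)])
    finally show ?case by (simp add: mult.commute)
  qed
  also have "\<dots> = c * emeasure ?N B'" using B' by (simp add: nn_integral_cmult cd)
  finally show ?thesis
    using c_pos c_fin by (subst (asm) ennreal_mult_le_mult_iff) (auto simp: top_unique)
qed

section \<open>Fourth moments and the law of large numbers on spheres\<close>

text \<open>
  Lower powers are dominated by \<open>1 + y ^ 4\<close>.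
\<close>

lemma (in prob_space) integrable_power_le_4:
  fixes Y :: "'a \<Rightarrow> real"
  assumes [measurable]: "Y \<in> borel_measurable M" and int: "integrable M (\<lambda>x. Y x ^ 4)" and k: "k \<le> 4"
  shows "integrable M (\<lambda>x. Y x ^ k)"
proof (rule Bochner_Integration.integrable_bound)
  show "integrable M (\<lambda>x. 1 + Y x ^ 4)" using int by simp
  have "\<bar>y\<bar> ^ k \<le> 1 + y ^ 4" for y :: real
  proof (cases "\<bar>y\<bar> \<le> 1")
    case True
    then have "\<bar>y\<bar> ^ k \<le> 1" by (intro power_le_one) auto
    then show ?thesis by (smt (verit) zero_le_even_power even_numeral)
  next
    case False
    then have "\<bar>y\<bar> ^ k \<le> \<bar>y\<bar> ^ 4" using k by (intro power_increasing) auto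
    then show ?thesis by simp
  qed
  then show "AE x in M. norm (Y x ^ k) \<le> norm (1 + Y x ^ 4)"
    by (intro AE_I2) (simp add: power_abs)
qed simp

text \<open>
  In the expansion of the fourth power, all terms with an isolated centred factor have zero
  expectation; the number of the others is of order \<open>n\<^sup>2\<close>.  The claims on the first two moments are
  part of the statement because the induction uses them.
\<close>

lemma (in prob_space) fourth_moment_sum:
  fixes Y :: "nat \<Rightarrow> 'a \<Rightarrow> real" and m :: real
  assumes J: "finite J" "indep_vars (\<lambda>_. borel) Y J" and m: "1 \<le> m"
    and int: "\<And>i. i \<in> J \<Longrightarrow> integrable M (\<lambda>x. Y i x ^ 4)"
    and mean: "\<And>i. i \<in> J \<Longrightarrow> expectation (Y i) = 0"
    and sq: "\<And>i. i \<in> J \<Longrightarrow> expectation (\<lambda>x. Y i x ^ 2) \<le> m"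
    and fourth: "\<And>i. i \<in> J \<Longrightarrow> expectation (\<lambda>x. Y i x ^ 4) \<le> m"
  shows "integrable M (\<lambda>x. (\<Sum>i\<in>J. Y i x) ^ 4) \<and> expectation (\<lambda>x. \<Sum>i\<in>J. Y i x) = 0
    \<and> expectation (\<lambda>x. (\<Sum>i\<in>J. Y i x) ^ 2) \<le> real (card J) * m
    \<and> expectation (\<lambda>x. (\<Sum>i\<in>J. Y i x) ^ 4) \<le> 3 * (real (card J))\<^sup>2 * m\<^sup>2"
  using J int mean sq fourth
proof (induction J rule: finite_induct)
  case empty
  then show ?case by simp
next
  case (insert i J)
  define S where "S x = (\<Sum>j\<in>J. Y j x)" for x
  define V where "V = Y i"
  define k where "k = real (card J)"
  have J: "indep_vars (\<lambda>_. borel) Y J" using insert.prems(1) by (rule indep_vars_subset) auto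
  have rv: "Y j \<in> borel_measurable M" if "j \<in> insert i J" for j
    using insert.prems(1) that by (auto simp: indep_vars_def2)
  have [measurable]: "V \<in> borel_measurable M" "S \<in> borel_measurable M"
    using rv by (auto simp: V_def S_def[abs_def] intro!: borel_measurable_sum)
  have IH: "integrable M (\<lambda>x. S x ^ 4)" "expectation S = 0"
    "expectation (\<lambda>x. S x ^ 2) \<le> k * m" "expectation (\<lambda>x. S x ^ 4) \<le> 3 * k\<^sup>2 * m\<^sup>2"
    using insert.IH[OF J] insert.prems by (simp_all add: S_def[abs_def] k_def)
  have Vint: "integrable M (\<lambda>x. V x ^ 4)" using insert.prems by (simp add: V_def)
  have V: "expectation V = 0" "expectation (\<lambda>x. V x ^ 2) \<le> m" "expectation (\<lambda>x. V x ^ 4) \<le> m"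
    using insert.prems by (simp_all add: V_def)
  have ind: "indep_var borel V borel S"
    using indep_vars_sum[OF insert.hyps insert.prems(1)] by (simp add: V_def S_def[abs_def])
  have pr: "integrable M (\<lambda>x. V x ^ a * S x ^ b) \<and>
      expectation (\<lambda>x. V x ^ a * S x ^ b) = expectation (\<lambda>x. V x ^ a) * expectation (\<lambda>x. S x ^ b)"
    if "a \<le> 4" "b \<le> 4" for a b
  proof -
    have "indep_var borel ((\<lambda>v. v ^ a) \<circ> V) borel ((\<lambda>s. s ^ b) \<circ> S)"
      by (rule indep_var_compose[OF ind]) auto
    then have "indep_var borel (\<lambda>x. V x ^ a) borel (\<lambda>x. S x ^ b)" by (simp add: o_def)
    moreover have "integrable M (\<lambda>x. V x ^ a)" "integrable M (\<lambda>x. S x ^ b)"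
      using that Vint IH by (auto intro: integrable_power_le_4)
    ultimately show ?thesis using indep_var_integrable indep_var_lebesgue_integral by blast
  qed
  have sum: "(\<Sum>j\<in>insert i J. Y j x) = V x + S x" for x
    using insert.hyps by (simp add: V_def S_def)
  have e2: "(V x + S x) ^ 2 = V x ^ 2 * S x ^ 0 + 2 * (V x ^ 1 * S x ^ 1) + V x ^ 0 * S x ^ 2" for x
    by (simp add: power2_eq_square algebra_simps)
  have e4: "(V x + S x) ^ 4 = V x ^ 4 * S x ^ 0 + 4 * (V x ^ 3 * S x ^ 1) + 6 * (V x ^ 2 * S x ^ 2)
      + 4 * (V x ^ 1 * S x ^ 3) + V x ^ 0 * S x ^ 4" for x
    by (simp add: power2_eq_square power3_eq_cube power4_eq_xxxx algebra_simps)
  have i4: "integrable M (\<lambda>x. (V x + S x) ^ 4)"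
    unfolding e4 by (intro Bochner_Integration.integrable_add integrable_mult_right conjunct1[OF pr]) auto
  have E1: "expectation (\<lambda>x. V x + S x) = 0"
    using integrable_power_le_4[of V 1] integrable_power_le_4[of S 1] Vint IH V by simp
  have E2: "expectation (\<lambda>x. (V x + S x) ^ 2) = expectation (\<lambda>x. V x ^ 2) + expectation (\<lambda>x. S x ^ 2)"
    unfolding e2 using pr[of 2 0] pr[of 1 1] pr[of 0 2] V(1) IH(2)
    by (simp add: prob_space)
  have E4: "expectation (\<lambda>x. (V x + S x) ^ 4) = expectation (\<lambda>x. V x ^ 4)
      + 6 * (expectation (\<lambda>x. V x ^ 2) * expectation (\<lambda>x. S x ^ 2)) + expectation (\<lambda>x. S x ^ 4)"
    unfolding e4 using pr[of 4 0] pr[of 3 1] pr[of 2 2] pr[of 1 3] pr[of 0 4] V(1) IH(2)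
    by (simp add: prob_space)
  have c: "real (card (insert i J)) = k + 1" using insert.hyps by (simp add: k_def)
  have "expectation (\<lambda>x. V x ^ 2) * expectation (\<lambda>x. S x ^ 2) \<le> m * (k * m)"
    using V IH m by (intro mult_mono) (auto simp: k_def)
  moreover have "m \<le> m\<^sup>2" using m by (simp add: power2_eq_square)
  ultimately have "expectation (\<lambda>x. (V x + S x) ^ 4) \<le> m\<^sup>2 + 6 * (k * m\<^sup>2) + 3 * k\<^sup>2 * m\<^sup>2"
    using V IH unfolding E4 by (simp add: power2_eq_square algebra_simps)
  also have "\<dots> \<le> 3 * (k + 1)\<^sup>2 * m\<^sup>2"
    by (simp add: power2_eq_square algebra_simps)
  finally show ?case
    unfolding sum c of_nat_power using i4 E1 E2 V IH c by (simp add: algebra_simps)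
qed

lemma gaussian_vector_component_distr:
  assumes "i \<in> J"
  shows "distr (gaussian_vector J) borel (\<lambda>g. g i) = std_gaussian"
proof -
  have "distr (gaussian_vector J) borel (\<lambda>g. g i) = distr (gaussian_vector J) std_gaussian (\<lambda>g. g i)"
    by (rule distr_cong) auto
  also have "\<dots> = std_gaussian" using assms by (rule gaussian_product.PiM_component)
  finally show ?thesis .
qed

lemma gaussian_vector_indep:
  assumes "J \<noteq> {}"
  shows "prob_space.indep_vars (gaussian_vector J) (\<lambda>_. borel) (\<lambda>i g. g i) J"
proof (subst prob_space.indep_vars_iff_distr_eq_PiM'[OF prob_space_gaussian_vector assms])
  show "(\<lambda>g. g i) \<in> borel_measurable (gaussian_vector J)" if "i \<in> J" for i
    using that by (rule gaussian_vector_component)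
  have "distr (gaussian_vector J) (\<Pi>\<^sub>M i\<in>J. borel) (\<lambda>x. \<lambda>i\<in>J. x i) = distr (gaussian_vector J) (gaussian_vector J) (\<lambda>x. x)"
    by (rule distr_cong) (auto simp: sets_gaussian_vector space_PiM PiE_def extensional_restrict)
  also have "\<dots> = gaussian_vector J" by (rule distr_id)
  also have "\<dots> = (\<Pi>\<^sub>M i\<in>J. distr (gaussian_vector J) borel (\<lambda>g. g i))"
    by (rule PiM_cong) (auto simp: gaussian_vector_component_distr)
  finally show "distr (gaussian_vector J) (\<Pi>\<^sub>M i\<in>J. borel) (\<lambda>x. \<lambda>i\<in>J. x i)
    = (\<Pi>\<^sub>M i\<in>J. distr (gaussian_vector J) borel (\<lambda>g. g i))" .
qed

definition empirical_deviation :: "(real \<Rightarrow> real) \<Rightarrow> real \<Rightarrow> nat \<Rightarrow> (nat \<Rightarrow> real) set" where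
  "empirical_deviation f \<epsilon> n = {g \<in> space (gaussian_vector {1..n}). \<epsilon> * real n \<le> \<bar>\<Sum>i=1..n. f (g i)\<bar>}"

lemma sum_component_measurable:
  assumes [measurable]: "f \<in> borel_measurable borel"
  shows "(\<lambda>g. \<Sum>i\<in>J. f (g i) :: real) \<in> borel_measurable (gaussian_vector J)"
  by (intro borel_measurable_sum measurable_compose[OF gaussian_vector_component assms])

lemma empirical_deviation_sets:
  assumes "f \<in> borel_measurable borel"
  shows "empirical_deviation f \<epsilon> n \<in> sets (gaussian_vector {1..n})"
proof -
  note [measurable] = sum_component_measurable[OF assms, of "{1..n}"]
  show ?thesis unfolding empirical_deviation_def by measurable
qed

text \<open>
  Markov's inequality for the fourth power.  Second moments would only give \<open>C / n\<close>, which is not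
  summable.
\<close>

lemma empirical_deviation_bound:
  assumes f [measurable]: "f \<in> borel_measurable borel"
    and int: "integrable std_gaussian (\<lambda>u. f u ^ 4)"
    and mean: "(\<integral>u. f u \<partial>std_gaussian) = 0" and \<epsilon>: "\<epsilon> > 0"
  shows "\<exists>C\<ge>0. \<forall>n\<ge>1. measure (gaussian_vector {1..n}) (empirical_deviation f \<epsilon> n) \<le> C / (real n)\<^sup>2"
proof -
  \<comment> \<open>The summand \<open>1\<close> ensures \<open>m \<le> m\<^sup>2\<close>.\<close>
  define m where "m = 1 + \<bar>\<integral>u. f u ^ 4 \<partial>std_gaussian\<bar> + \<bar>\<integral>u. f u ^ 2 \<partial>std_gaussian\<bar>"
  have "measure (gaussian_vector {1..n}) (empirical_deviation f \<epsilon> n) \<le> (3 * m\<^sup>2 / \<epsilon> ^ 4) / (real n)\<^sup>2"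
    if n: "n \<ge> 1" for n
  proof -
    let ?N = "gaussian_vector {1..n}"
    interpret N: prob_space ?N by (rule prob_space_gaussian_vector)
    note N = prob_space_gaussian_vector[of "{1..n}"]
    have E: "(\<integral>g. h (g i) \<partial>?N) = (\<integral>u. h u \<partial>std_gaussian)"
      if "i \<in> {1..n}" "h \<in> borel_measurable borel" for i and h :: "real \<Rightarrow> real"
      using integral_distr[OF gaussian_vector_component[OF that(1)] that(2)]
      by (simp add: gaussian_vector_component_distr[OF that(1)] del: One_nat_def)
    have I: "integrable ?N (\<lambda>g. f (g i) ^ 4)" if "i \<in> {1..n}" for i
      using integrable_distr_eq[OF gaussian_vector_component[OF that], of "\<lambda>u. f u ^ 4"] int
      by (simp add: gaussian_vector_component_distr[OF that] del: One_nat_def)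
    have ind: "prob_space.indep_vars ?N (\<lambda>_. borel) (\<lambda>i g. f (g i)) {1..n}"
      using n by (intro prob_space.indep_vars_compose2[OF N gaussian_vector_indep]) auto
    have fm: "integrable ?N (\<lambda>g. (\<Sum>i=1..n. f (g i)) ^ 4)"
      "(\<integral>g. (\<Sum>i=1..n. f (g i)) ^ 4 \<partial>?N) \<le> 3 * (real (card {1..n}))\<^sup>2 * m\<^sup>2"
      using prob_space.fourth_moment_sum[OF N _ ind, where m = m] I E[of _ f] E[of _ "\<lambda>u. f u ^ 4"] E[of _ "\<lambda>u. f u ^ 2"]
      by (auto simp: m_def mean)
    have "empirical_deviation f \<epsilon> n = {g\<in>space ?N. (\<epsilon> * real n) ^ 4 \<le> (\<Sum>i=1..n. f (g i)) ^ 4}"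
    proof -
      have "\<epsilon> * real n \<le> \<bar>s\<bar> \<longleftrightarrow> (\<epsilon> * real n) ^ 4 \<le> s ^ 4" for s :: real
        using \<epsilon> power_mono_iff[of "\<epsilon> * real n" "\<bar>s\<bar>" 4] by simp
      then show ?thesis by (auto simp: empirical_deviation_def)
    qed
    then have "measure ?N (empirical_deviation f \<epsilon> n)
        \<le> (\<integral>g. (\<Sum>i=1..n. f (g i)) ^ 4 \<partial>?N) / (\<epsilon> * real n) ^ 4"
      using integral_Markov_inequality_measure[OF fm(1) sets.top, of "(\<epsilon> * real n) ^ 4"] n \<epsilon> by simp
    also have "\<dots> \<le> (3 * (real n)\<^sup>2 * m\<^sup>2) / (\<epsilon> * real n) ^ 4"
      using fm(2) \<epsilon> by (intro divide_right_mono) auto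
    also have "\<dots> = (3 * m\<^sup>2 / \<epsilon> ^ 4) / (real n)\<^sup>2"
      using n \<epsilon> by (simp add: field_simps power2_eq_square power4_eq_xxxx)
    finally show ?thesis .
  qed
  then show ?thesis by (intro exI[of _ "3 * m\<^sup>2 / \<epsilon> ^ 4"]) auto
qed

text \<open>
  \<open>H\<close> takes the place of \<open>\<Lambda>\<close>, and \<open>\<Psi>\<close> is its Gaussian average.
\<close>

locale gaussian_convex_average =
  fixes H \<Psi> :: "real \<Rightarrow> real"
  assumes convex: "convex_on UNIV H"
    and int4: "\<And>t. integrable std_gaussian (\<lambda>u. H (t * u) ^ 4)"
    and \<Psi>: "\<And>t. \<Psi> t = (\<integral>u. H (t * u) \<partial>std_gaussian)"
    and cont: "\<And>t. isCont \<Psi> t"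
begin

lemma H_continuous: "continuous_on UNIV H"
  using convex by (intro convex_on_continuous) auto

lemma H_measurable [measurable]: "H \<in> borel_measurable borel"
  using H_continuous by (rule borel_measurable_continuous_onI)

text \<open>
  Outside four events of probability of order \<open>1 / n\<^sup>2\<close>, the squared norm of \<open>g\<close> is close to \<open>n\<close> and
  the convex function \<open>G t = 1 / n * (\<Sum>i. H (t * g i))\<close> is close to \<open>\<Psi> p\<close> at \<open>p - d\<close>, \<open>p\<close> and \<open>p + d\<close>.
  Normalizing \<open>g\<close> to length \<open>sqrt n\<close> means evaluating \<open>G\<close> at a point within \<open>d\<close> of \<open>p\<close>, and the
  three-point bound applies.
\<close>

lemma gaussian_normalized_deviation:
  assumes \<epsilon>: "\<epsilon> > 0"
  shows "\<exists>C\<ge>0. \<forall>n\<ge>1. measure (gaussian_vector {1..n})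
    {g \<in> space (gaussian_vector {1..n}).
      \<epsilon> \<le> \<bar>1 / real n * (\<Sum>i=1..n. H (p * (sqrt (real n) * (g i / sqrt (\<Sum>i=1..n. (g i)\<^sup>2))))) - \<Psi> p\<bar>}
    \<le> C / (real n)\<^sup>2"
proof -
  \<comment> \<open>The three-point bound costs \<open>3 * (2 * \<eta>) < \<epsilon>\<close>: one \<open>\<eta>\<close> for the empirical mean and one for the continuity of \<open>\<Psi>\<close>.\<close>
  define \<eta> where "\<eta> = \<epsilon> / 8"
  have \<eta>: "\<eta> > 0" using \<epsilon> by (simp add: \<eta>_def)
  from cont[of p] \<eta> obtain d0 where d0: "d0 > 0" "\<And>x. \<bar>x - p\<bar> < d0 \<Longrightarrow> \<bar>\<Psi> x - \<Psi> p\<bar> < \<eta>"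
    unfolding continuous_at_real_range real_norm_def by blast
  define d where "d = d0 / 2"
  have d: "d > 0" "\<bar>\<Psi> (p - d) - \<Psi> p\<bar> < \<eta>" "\<bar>\<Psi> (p + d) - \<Psi> p\<bar> < \<eta>"
    using d0 by (auto simp: d_def)
  have "isCont (\<lambda>v. p / sqrt v) 1" by (intro continuous_intros) auto
  with d(1) obtain e where e: "e > 0" "\<And>v. \<bar>v - 1\<bar> < e \<Longrightarrow> \<bar>p / sqrt v - p / sqrt 1\<bar> < d"
    unfolding continuous_at_real_range real_norm_def by blast
  have e': "\<bar>p / sqrt v - p\<bar> \<le> d" if "\<bar>v - 1\<bar> < e" for v
    using e(2)[OF that] by simp
  define f where "f t u = H (t * u) - \<Psi> t" for t u
  define s where "s u = u\<^sup>2 - 1" for u :: real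
  have [measurable]: "f t \<in> borel_measurable borel" "s \<in> borel_measurable borel" for t
    unfolding f_def s_def by measurable
  have pw: "integrable std_gaussian (\<lambda>u. H (t * u) ^ k)" if "k \<le> 4" for t k
    by (rule std_gaussian.integrable_power_le_4[OF _ int4 that]) measurable
  have "\<exists>C\<ge>0. \<forall>n\<ge>1. measure (gaussian_vector {1..n}) (empirical_deviation (f t) \<eta> n) \<le> C / (real n)\<^sup>2" for t
  proof (rule empirical_deviation_bound)
    have "integrable std_gaussian (\<lambda>u. H (t * u) ^ 4 - 4 * \<Psi> t * H (t * u) ^ 3 + 6 * (\<Psi> t)\<^sup>2 * H (t * u) ^ 2
      - 4 * (\<Psi> t) ^ 3 * H (t * u) ^ 1 + (\<Psi> t) ^ 4)"
      by (intro Bochner_Integration.integrable_add Bochner_Integration.integrable_diff integrable_mult_right pw) auto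
    moreover have "f t u ^ 4 = H (t * u) ^ 4 - 4 * \<Psi> t * H (t * u) ^ 3 + 6 * (\<Psi> t)\<^sup>2 * H (t * u) ^ 2
      - 4 * (\<Psi> t) ^ 3 * H (t * u) ^ 1 + (\<Psi> t) ^ 4" for u
      by (simp add: f_def power2_eq_square power3_eq_cube power4_eq_xxxx algebra_simps)
    ultimately show "integrable std_gaussian (\<lambda>u. f t u ^ 4)" by simp
    show "(\<integral>u. f t u \<partial>std_gaussian) = 0"
      using pw[of 1 t] by (simp add: f_def \<Psi> std_gaussian.prob_space[simplified])
  qed (use \<eta> in auto)
  then obtain C where C: "\<And>t. C t \<ge> 0"
    "\<And>t n. n \<ge> 1 \<Longrightarrow> measure (gaussian_vector {1..n}) (empirical_deviation (f t) \<eta> n) \<le> C t / (real n)\<^sup>2"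
    by metis
  have "\<exists>C\<ge>0. \<forall>n\<ge>1. measure (gaussian_vector {1..n}) (empirical_deviation s e n) \<le> C / (real n)\<^sup>2"
  proof (rule empirical_deviation_bound)
    have m: "integrable std_gaussian (\<lambda>u. u ^ k)" for k
      by (subst integrable_std_gaussian) (auto intro: integrable_std_normal_moment)
    have "s u ^ 4 = u ^ 8 - 4 * u ^ 6 + 6 * u ^ 4 - 4 * u ^ 2 + 1" for u
      by (simp add: s_def eval_nat_numeral algebra_simps)
    then show "integrable std_gaussian (\<lambda>u. s u ^ 4)"
      using m by (auto intro!: Bochner_Integration.integrable_add Bochner_Integration.integrable_diff)
    have "(\<integral>u. u\<^sup>2 \<partial>std_gaussian) = 1"
      using integral_std_normal_moment_even[of 1] by (subst integral_std_gaussian) (auto simp: fact_numeral)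
    then show "(\<integral>u. s u \<partial>std_gaussian) = 0"
      using m[of 2] by (simp add: s_def std_gaussian.prob_space[simplified])
  qed (use e in auto)
  then obtain D where D: "D \<ge> 0"
    "\<And>n. n \<ge> 1 \<Longrightarrow> measure (gaussian_vector {1..n}) (empirical_deviation s e n) \<le> D / (real n)\<^sup>2"
    by metis
  show ?thesis
  proof (intro exI[of _ "D + C (p - d) + C p + C (p + d)"] conjI allI impI)
    show "0 \<le> D + C (p - d) + C p + C (p + d)" using C(1) D(1) by simp
    fix n :: nat assume n: "n \<ge> 1"
    let ?N = "gaussian_vector {1..n}"
    let ?E = "empirical_deviation s e n" and ?F = "\<lambda>t. empirical_deviation (f t) \<eta> n"
    let ?B = "{g \<in> space ?N.
      \<epsilon> \<le> \<bar>1 / real n * (\<Sum>i=1..n. H (p * (sqrt (real n) * (g i / sqrt (\<Sum>i=1..n. (g i)\<^sup>2))))) - \<Psi> p\<bar>}"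
    have EF: "?E \<in> sets ?N" "?F t \<in> sets ?N" for t
      by (rule empirical_deviation_sets, simp)+
    have "?B \<subseteq> ?E \<union> ?F (p - d) \<union> ?F p \<union> ?F (p + d)"
    proof (rule subsetI, rule ccontr)
      fix g assume g: "g \<in> ?B" and not: "g \<notin> ?E \<union> ?F (p - d) \<union> ?F p \<union> ?F (p + d)"
      define G where "G t = 1 / real n * (\<Sum>i=1..n. H (t * g i))" for t
      define v where "v = (\<Sum>i=1..n. (g i)\<^sup>2) / real n"
      have G: "convex_on UNIV G" unfolding G_def by (rule convex_on_average[OF convex])
      have close: "\<bar>G t - \<Psi> t\<bar> < \<eta>" if "g \<notin> ?F t" for t
      proof -
        have "\<bar>\<Sum>i=1..n. f t (g i)\<bar> < \<eta> * real n"
          using that g by (simp add: empirical_deviation_def not_le)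
        moreover have "(\<Sum>i=1..n. f t (g i)) = real n * (G t - \<Psi> t)"
          using n by (simp add: f_def sum_subtractf G_def field_simps)
        ultimately show ?thesis using n by (simp add: abs_mult)
      qed
      have "\<bar>v - 1\<bar> < e"
      proof -
        have "\<bar>\<Sum>i=1..n. s (g i)\<bar> < e * real n"
          using not g by (simp add: empirical_deviation_def not_le)
        moreover have "(\<Sum>i=1..n. s (g i)) = real n * (v - 1)"
          using n by (simp add: s_def sum_subtractf v_def field_simps)
        ultimately show ?thesis using n by (simp add: abs_mult)
      qed
      then have y: "\<bar>p / sqrt v - p\<bar> \<le> d" by (rule e')
      have "p * (sqrt (real n) * (g i / sqrt (\<Sum>i=1..n. (g i)\<^sup>2))) = p / sqrt v * g i" for i
        using n by (simp add: v_def real_sqrt_divide)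
      then have "\<epsilon> \<le> \<bar>G (p / sqrt v) - \<Psi> p\<bar>" using g by (simp add: G_def)
      moreover have "\<bar>G (p / sqrt v) - \<Psi> p\<bar> \<le> 3 * (2 * \<eta>)"
      proof (rule convex_three_point_bound[OF G _ _ _ y])
        show "\<bar>G (p - d) - \<Psi> p\<bar> \<le> 2 * \<eta>" using close[of "p - d"] not d by auto
        show "\<bar>G p - \<Psi> p\<bar> \<le> 2 * \<eta>" using close[of p] not \<eta> by auto
        show "\<bar>G (p + d) - \<Psi> p\<bar> \<le> 2 * \<eta>" using close[of "p + d"] not d by auto
      qed
      ultimately show False using \<epsilon> by (simp add: \<eta>_def)
    qed
    then have "measure ?N ?B \<le> measure ?N (?E \<union> ?F (p - d) \<union> ?F p \<union> ?F (p + d))"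
      by (rule finite_measure.finite_measure_mono[OF prob_space.finite_measure[OF prob_space_gaussian_vector]])
         (intro sets.Un EF)
    also have "\<dots> \<le> measure ?N ?E + measure ?N (?F (p - d)) + measure ?N (?F p) + measure ?N (?F (p + d))"
      by (intro order_trans[OF measure_Un_le] add_mono order_refl sets.Un EF)
    also have "\<dots> \<le> (D + C (p - d) + C p + C (p + d)) / (real n)\<^sup>2"
      unfolding add_divide_distrib using C(2)[OF n] D(2)[OF n] by (intro add_mono) auto
    finally show "measure ?N ?B \<le> (D + C (p - d) + C p + C (p + d)) / (real n)\<^sup>2" .
  qed
qed

end

context gaussian_convex_average
begin

text \<open>
  For fixed \<open>n\<close> the average is uniformly continuous on the sphere, so a direction within a small
  angle of a deviating \<open>\<theta>\<close> deviates by at least \<open>\<epsilon> / 2\<close>, and \<open>sphere_measure_le_gaussian\<close> transfers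
  the Gaussian bound.  The constant is the same for all \<open>n\<close> because the angle does not enter it.
\<close>

lemma sphere_deviation:
  assumes \<epsilon>: "\<epsilon> > 0"
  shows "\<exists>C\<ge>0. \<forall>n\<ge>1. \<forall>M. rotation_invariant_prob n M \<longrightarrow>
    measure M {\<theta> \<in> space M. \<epsilon> \<le> \<bar>1 / real n * (\<Sum>i=1..n. H (p * (sqrt (real n) * \<theta> i))) - \<Psi> p\<bar>}
    \<le> C / (real n)\<^sup>2"
proof -
  define B' where "B' n = {g \<in> space (gaussian_vector {1..n}).
      \<epsilon> / 2 \<le> \<bar>1 / real n * (\<Sum>i=1..n. H (p * (sqrt (real n) * (g i / sqrt (\<Sum>i=1..n. (g i)\<^sup>2))))) - \<Psi> p\<bar>}" for n
  from gaussian_normalized_deviation[of "\<epsilon> / 2" p] \<epsilon> obtain C where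
    C: "C \<ge> 0" "\<And>n. n \<ge> 1 \<Longrightarrow> measure (gaussian_vector {1..n}) (B' n) \<le> C / (real n)\<^sup>2"
    unfolding B'_def by auto
  show ?thesis
  proof (intro exI[of _ C] conjI allI impI)
    show "0 \<le> C" by (rule C)
    fix n :: nat and M assume n: "n \<ge> 1" and M: "rotation_invariant_prob n M"
    let ?B = "{\<theta> \<in> space M. \<epsilon> \<le> \<bar>1 / real n * (\<Sum>i=1..n. H (p * (sqrt (real n) * \<theta> i))) - \<Psi> p\<bar>}"
    interpret M: prob_space M using M by (simp add: rotation_invariant_prob_def)
    have sM: "sets M = sets (sphere_borel n)"
      using M by (auto simp: rotation_invariant_prob_def)
    have space: "space M = unit_sphere n"
      using sets_eq_imp_space_eq[OF sM] by (simp add: space_sphere_borel)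
    have [measurable]: "(\<lambda>\<theta>. \<theta> i) \<in> borel_measurable M" if "i \<in> {1..n}" for i
      using measurable_sphere_component[OF that] by (simp add: measurable_cong_sets[OF sM refl])
    have [measurable]: "(\<lambda>g. g i) \<in> borel_measurable (gaussian_vector {1..n})" if "i \<in> {1..n}" for i
      using that by (rule gaussian_vector_component)
    define h where "h x = H (p * (sqrt (real n) * x))" for x
    have "continuous_on {-1..1} h"
      unfolding h_def by (intro continuous_on_compose2[OF H_continuous] continuous_intros) auto
    then have "uniformly_continuous_on {-1..1} h"
      by (rule compact_uniformly_continuous) simp
    then obtain d where d: "d > 0"
      "\<And>x y. x \<in> {-1..1} \<Longrightarrow> y \<in> {-1..1} \<Longrightarrow> \<bar>y - x\<bar> < d \<Longrightarrow> \<bar>h y - h x\<bar> < \<epsilon> / 2"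
      using \<epsilon> unfolding uniformly_continuous_on_def dist_real_def
      by (metis half_gt_zero)
    \<comment> \<open>Unit vectors with inner product greater than \<open>\<kappa>\<close> are at distance less than \<open>d\<close>.\<close>
    define \<kappa> where "\<kappa> = max 0 (1 - d\<^sup>2 / 2)"
    have \<kappa>: "0 \<le> \<kappa>" "\<kappa> < 1" "1 - d\<^sup>2 / 2 \<le> \<kappa>" using d(1) by (auto simp: \<kappa>_def)
    have "emeasure M ?B \<le> emeasure (gaussian_vector {1..n}) (B' n)"
    proof (rule sphere_measure_le_gaussian[OF n M _ _ \<kappa>(1,2)])
      show "?B \<in> sets M" by measurable
      show "B' n \<in> sets (gaussian_vector {1..n})" unfolding B'_def by measurable
      fix \<theta> g assume \<theta>: "\<theta> \<in> ?B" and g: "g \<in> space (gaussian_vector {1..n})" and c: "cone n \<kappa> \<theta> g"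
      define r where "r = sqrt (\<Sum>i=1..n. (g i)\<^sup>2)"
      have sq: "(\<Sum>i=1..n. (g i)\<^sup>2) \<ge> 0" by (intro sum_nonneg) auto
      have unit: "(\<Sum>i=1..n. (\<theta> i)\<^sup>2) = 1" using \<theta> by (simp add: space unit_sphere_iff)
      have r0: "r \<noteq> 0"
      proof
        assume "r = 0"
        then have "\<forall>i\<in>{1..n}. g i = 0" by (simp add: r_def sum_nonneg_eq_0_iff)
        with c show False by (simp add: cone_def)
      qed
      then have r: "r > 0" "r\<^sup>2 = (\<Sum>i=1..n. (g i)\<^sup>2)" using sq by (auto simp: r_def less_le)
      define \<eta> where "\<eta> i = g i / r" for i
      have \<eta>: "(\<Sum>i=1..n. (\<eta> i)\<^sup>2) = 1"
        unfolding \<eta>_def power_divide sum_divide_distrib[symmetric] r(2)[symmetric] using r(1) by simp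
      have inner: "\<kappa> < (\<Sum>i=1..n. \<theta> i * \<eta> i)"
      proof -
        have "(\<Sum>i=1..n. \<theta> i * \<eta> i) = (\<Sum>i=1..n. \<theta> i * g i) / r"
          by (simp add: \<eta>_def sum_divide_distrib)
        then show ?thesis
          using c r(1) by (simp add: cone_def r_def[symmetric] pos_less_divide_eq del: One_nat_def)
      qed
      have dist: "(\<Sum>i=1..n. (\<theta> i - \<eta> i)\<^sup>2) < d\<^sup>2"
      proof -
        have "(\<Sum>i=1..n. (\<theta> i - \<eta> i)\<^sup>2) = (\<Sum>i=1..n. (\<theta> i)\<^sup>2 + (\<eta> i)\<^sup>2 - 2 * (\<theta> i * \<eta> i))"
          by (intro sum.cong refl) (simp add: power2_eq_square algebra_simps)
        also have "\<dots> = 2 - 2 * (\<Sum>i=1..n. \<theta> i * \<eta> i)"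
          unfolding sum_subtractf sum.distrib unit \<eta> sum_distrib_left by simp
        finally show ?thesis using inner \<kappa>(3) by linarith
      qed
      have comp: "(x i)\<^sup>2 \<le> (\<Sum>i=1..n. (x i)\<^sup>2)" if "i \<in> {1..n}" for i and x :: "nat \<Rightarrow> real"
        using that by (intro member_le_sum) auto
      have hd: "\<bar>h (\<eta> i) - h (\<theta> i)\<bar> < \<epsilon> / 2" if i: "i \<in> {1..n}" for i
      proof (rule d(2))
        show "\<theta> i \<in> {-1..1}" using comp[OF i, of \<theta>] unfolding unit abs_square_le_1 by auto
        show "\<eta> i \<in> {-1..1}" using comp[OF i, of \<eta>] unfolding \<eta> abs_square_le_1 by auto
        have "(\<theta> i - \<eta> i)\<^sup>2 < d\<^sup>2" using comp[OF i, of "\<lambda>i. \<theta> i - \<eta> i"] dist by linarith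
        then have "\<bar>\<theta> i - \<eta> i\<bar> < d"
          using d(1) power2_less_imp_less[of "\<bar>\<theta> i - \<eta> i\<bar>" d] by simp
        then show "\<bar>\<eta> i - \<theta> i\<bar> < d" by (simp add: abs_minus_commute)
      qed
      have "\<bar>(\<Sum>i=1..n. h (\<eta> i)) - (\<Sum>i=1..n. h (\<theta> i))\<bar> \<le> (\<Sum>i=1..n. \<bar>h (\<eta> i) - h (\<theta> i)\<bar>)"
        unfolding sum_subtractf[symmetric] by (rule sum_abs)
      also have "\<dots> \<le> (\<Sum>i=1..n. \<epsilon> / 2)" using hd by (intro sum_mono less_imp_le) auto
      finally have "\<bar>1 / real n * (\<Sum>i=1..n. h (\<eta> i)) - 1 / real n * (\<Sum>i=1..n. h (\<theta> i))\<bar> \<le> \<epsilon> / 2"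
        using n by (simp add: right_diff_distrib[symmetric] abs_mult field_simps)
      moreover have "\<epsilon> \<le> \<bar>1 / real n * (\<Sum>i=1..n. h (\<theta> i)) - \<Psi> p\<bar>" using \<theta> by (simp add: h_def)
      ultimately have "\<epsilon> / 2 \<le> \<bar>1 / real n * (\<Sum>i=1..n. h (\<eta> i)) - \<Psi> p\<bar>" by linarith
      then show "g \<in> B' n" using g by (simp add: B'_def h_def \<eta>_def r_def)
    qed
    then have "measure M ?B \<le> measure (gaussian_vector {1..n}) (B' n)"
      unfolding M.emeasure_eq_measure
        finite_measure.emeasure_eq_measure[OF prob_space.finite_measure[OF prob_space_gaussian_vector]]
      by simp
    also have "\<dots> \<le> C / (real n)\<^sup>2" by (rule C(2)[OF n])
    finally show "measure M ?B \<le> C / (real n)\<^sup>2" .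
  qed
qed

text \<open>
  The deviation probabilities are summable, so the Borel-Cantelli lemma applies; it involves
  only the law of each \<open>\<theta> n\<close>, which is what the hypothesis prescribes.
\<close>

lemma AE_sphere_average_tendsto:
  assumes \<sigma>: "prob_space \<sigma>" "sets \<sigma> = sets sphere_sequences"
    and inv: "\<And>n. n \<ge> 1 \<Longrightarrow> rotation_invariant_prob n (distr \<sigma> (sphere_borel n) (\<lambda>\<theta>. \<theta> n))"
  shows "AE \<theta> in \<sigma>. (\<lambda>n. 1 / real n * (\<Sum>i=1..n. H (p * (sqrt (real n) * \<theta> n i)))) \<longlonglongrightarrow> \<Psi> p"
proof -
  interpret prob_space \<sigma> by (rule \<sigma>(1))
  define a where "a n x = 1 / real n * (\<Sum>i=1..n. H (p * (sqrt (real n) * x i)))" for n :: nat and x :: "nat \<Rightarrow> real"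
  have proj: "(\<lambda>\<theta>. \<theta> n) \<in> measurable \<sigma> (sphere_borel n)" if "n \<ge> 1" for n
    using measurable_component_singleton[of n "{1..}" sphere_borel] that
    unfolding measurable_cong_sets[OF \<sigma>(2) refl] sphere_sequences_def by simp
  have a: "a n \<in> borel_measurable (sphere_borel n)" for n
  proof -
    note [measurable] = measurable_sphere_component
    show ?thesis unfolding a_def by measurable
  qed
  have "AE \<theta> in \<sigma>. eventually (\<lambda>n. \<bar>a n (\<theta> n) - \<Psi> p\<bar> < inverse (real (Suc k))) sequentially" for k
  proof -
    define \<epsilon> where "\<epsilon> = inverse (real (Suc k))"
    have \<epsilon>: "\<epsilon> > 0" by (simp add: \<epsilon>_def)
    define B where "B n = {x \<in> space (sphere_borel n). \<epsilon> \<le> \<bar>a n x - \<Psi> p\<bar>}" for n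
    \<comment> \<open>The law of \<open>\<theta> n\<close> is prescribed for \<open>n \<ge> 1\<close> only.\<close>
    define A where "A n = (if n = 0 then {} else (\<lambda>\<theta>. \<theta> n) -` B n \<inter> space \<sigma>)" for n
    have B: "B n \<in> sets (sphere_borel n)" for n
    proof -
      note [measurable] = a[of n]
      show ?thesis unfolding B_def by measurable
    qed
    have A: "A n \<in> sets \<sigma>" for n
      using measurable_sets[OF proj[of n] B] by (auto simp: A_def)
    from sphere_deviation[OF \<epsilon>, of p] obtain C where C: "C \<ge> 0"
      "\<And>n M. n \<ge> 1 \<Longrightarrow> rotation_invariant_prob n M \<Longrightarrow>
        measure M {\<theta> \<in> space M. \<epsilon> \<le> \<bar>a n \<theta> - \<Psi> p\<bar>} \<le> C / (real n)\<^sup>2"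
      unfolding a_def by blast
    have bound: "measure \<sigma> (A n) \<le> C / (real n)\<^sup>2" if n: "n \<ge> 1" for n
    proof -
      have "measure \<sigma> (A n) = measure (distr \<sigma> (sphere_borel n) (\<lambda>\<theta>. \<theta> n)) (B n)"
        using n by (simp add: measure_distr[OF proj[OF n] B] A_def)
      also have "\<dots> \<le> C / (real n)\<^sup>2"
        using C(2)[OF n inv[OF n]] by (simp add: B_def)
      finally show ?thesis .
    qed
    have "summable (\<lambda>n. measure \<sigma> (A n))"
    proof (rule summable_comparison_test'[where N=1])
      show "summable (\<lambda>n. C * inverse (real n ^ 2))"
        by (intro summable_mult inverse_power_summable) simp
      show "norm (measure \<sigma> (A n)) \<le> C * inverse (real n ^ 2)" if "n \<ge> 1" for n
        using bound[OF that] by (simp add: divide_inverse)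
    qed
    then have "AE \<theta> in \<sigma>. eventually (\<lambda>n. \<theta> \<in> space \<sigma> - A n) sequentially"
      using A by (intro borel_cantelli_AE1) (auto simp: less_top[symmetric])
    then show ?thesis
    proof eventually_elim
      case (elim \<theta>)
      then show ?case using eventually_ge_at_top[of 1]
      proof eventually_elim
        case (elim n)
        then have "\<theta> n \<in> space (sphere_borel n)" "\<theta> n \<notin> B n"
          using measurable_space[OF proj[of n], of \<theta>] by (auto simp: A_def split: if_splits)
        then show ?case by (simp add: B_def \<epsilon>_def not_le)
      qed
    qed
  qed
  then have "AE \<theta> in \<sigma>. \<forall>k. eventually (\<lambda>n. \<bar>a n (\<theta> n) - \<Psi> p\<bar> < inverse (real (Suc k))) sequentially"
    unfolding AE_all_countable by blast
  then have "AE \<theta> in \<sigma>. (\<lambda>n. a n (\<theta> n)) \<longlonglongrightarrow> \<Psi> p"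
  proof eventually_elim
    case (elim \<theta>)
    show ?case
    proof (rule tendstoI)
      fix e :: real assume "0 < e"
      then obtain k where "inverse (real (Suc k)) < e" using reals_Archimedean by blast
      with elim[rule_format, of k] show "eventually (\<lambda>n. dist (a n (\<theta> n)) (\<Psi> p) < e) sequentially"
        by (auto elim!: eventually_mono simp: dist_real_def)
    qed
  qed
  then show ?thesis by (simp add: a_def)
qed

lemma AE_sphere_average_tendsto_all:
  assumes \<sigma>: "prob_space \<sigma>" "sets \<sigma> = sets sphere_sequences"
    and inv: "\<And>n. n \<ge> 1 \<Longrightarrow> rotation_invariant_prob n (distr \<sigma> (sphere_borel n) (\<lambda>\<theta>. \<theta> n))"
  shows "AE \<theta> in \<sigma>. \<forall>t. (\<lambda>n. 1 / real n * (\<Sum>i=1..n. H (t * (sqrt (real n) * \<theta> n i)))) \<longlonglongrightarrow> \<Psi> t"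
proof -
  have "AE \<theta> in \<sigma>. \<forall>p\<in>\<rat>. (\<lambda>n. 1 / real n * (\<Sum>i=1..n. H (p * (sqrt (real n) * \<theta> n i)))) \<longlonglongrightarrow> \<Psi> p"
    using AE_sphere_average_tendsto[OF assms] by (intro AE_ball_countable') (auto intro: countable_rat)
  then show ?thesis
  proof eventually_elim
    case (elim \<theta>)
    show ?case
    proof
      fix t
      show "(\<lambda>n. 1 / real n * (\<Sum>i=1..n. H (t * (sqrt (real n) * \<theta> n i)))) \<longlonglongrightarrow> \<Psi> t"
        by (rule convex_tendsto_from_rationals[of "\<lambda>n t. 1 / real n * (\<Sum>i=1..n. H (t * (sqrt (real n) * \<theta> n i)))"])
           (use elim cont convex_on_average[OF convex] in auto)
    qed
  qed
qed

end

section \<open>Logarithmic moment generating functions\<close>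

text \<open>
  The moment condition makes the moment generating function finite everywhere, so that its
  logarithm is a real-valued convex function to which the preceding results apply.
\<close>

locale gaussian_integrable_cgf = prob_space P for P :: "'a measure" +
  fixes Y :: "'a \<Rightarrow> real"
  assumes Y [measurable]: "Y \<in> borel_measurable P"
    and moment: "\<And>t. (\<integral>\<^sup>+ u. e2ennreal (\<bar>log_mgf P Y (t * u)\<bar> ^ 4) \<partial>std_gaussian) < \<infinity>"
begin

text \<open>
  If the moment generating function were infinite at \<open>t\<close>, then also at \<open>t * u\<close> for all \<open>u \<ge> 1\<close>, and
  these \<open>u\<close> have positive Gaussian measure.
\<close>

lemma mgf_finite: "(\<integral>\<^sup>+ \<omega>. ennreal (exp (t * Y \<omega>)) \<partial>P) < \<infinity>"
proof (rule ccontr)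
  assume "\<not> ?thesis"
  then have inf: "(\<integral>\<^sup>+ \<omega>. ennreal (exp (t * Y \<omega>)) \<partial>P) = \<infinity>" by (simp add: less_top[symmetric])
  have big: "log_mgf P Y (t * u) = \<infinity>" if u: "u \<ge> 1" for u
  proof -
    have "exp (t * Y \<omega>) \<le> 1 + exp (t * u * Y \<omega>)" for \<omega>
    proof (cases "t * Y \<omega> \<ge> 0")
      case True
      then have "1 * (t * Y \<omega>) \<le> u * (t * Y \<omega>)" using u by (intro mult_right_mono) auto
      then have "exp (t * Y \<omega>) \<le> exp (t * u * Y \<omega>)" by (simp add: ac_simps)
      then show ?thesis by (rule add_increasing[OF zero_le_one])
    next
      case False
      then have "exp (t * Y \<omega>) \<le> 1" by simp
      then show ?thesis by (smt (verit) exp_ge_zero)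
    qed
    then have "(\<integral>\<^sup>+ \<omega>. ennreal (exp (t * Y \<omega>)) \<partial>P)
        \<le> (\<integral>\<^sup>+ \<omega>. 1 + ennreal (exp (t * u * Y \<omega>)) \<partial>P)"
      by (intro nn_integral_mono) (simp flip: ennreal_1 ennreal_plus)
    also have "\<dots> = 1 + (\<integral>\<^sup>+ \<omega>. ennreal (exp (t * u * Y \<omega>)) \<partial>P)"
      by (subst nn_integral_add) (auto simp: emeasure_space_1)
    finally have "(\<integral>\<^sup>+ \<omega>. ennreal (exp (t * u * Y \<omega>)) \<partial>P) = \<infinity>"
      by (simp add: inf top_unique)
    then show ?thesis by (simp add: log_mgf_def log_ennreal_def)
  qed
  have "(\<integral>\<^sup>+ u. \<infinity> * indicator {1<..<2::real} u \<partial>std_gaussian)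
      \<le> (\<integral>\<^sup>+ u. e2ennreal (\<bar>log_mgf P Y (t * u)\<bar> ^ 4) \<partial>std_gaussian)"
    by (intro nn_integral_mono) (auto simp: indicator_def big)
  moreover have "(\<integral>\<^sup>+ u. \<infinity> * indicator {1<..<2::real} u \<partial>std_gaussian)
      = \<infinity> * emeasure std_gaussian {1<..<2}"
    by (rule nn_integral_cmult_indicator) simp
  moreover have "\<infinity> * emeasure std_gaussian {1<..<2} = \<infinity>"
    using std_gaussian_pos[of "{1<..<2}"] by (simp add: ennreal_top_mult)
  ultimately show False using moment[of t] by (simp add: top_unique)
qed

lemma exp_integrable: "integrable P (\<lambda>\<omega>. exp (t * Y \<omega>))"
  using mgf_finite[of t] by (intro integrableI_nonneg) auto

lemma mgf_pos: "0 < expectation (\<lambda>\<omega>. exp (t * Y \<omega>))"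
proof -
  have "expectation (\<lambda>\<omega>. exp (t * Y \<omega>)) \<noteq> 0"
    using integral_nonneg_eq_0_iff_AE[OF exp_integrable[of t]] by (auto simp: AE_False)
  moreover have "0 \<le> expectation (\<lambda>\<omega>. exp (t * Y \<omega>))" by (rule integral_nonneg_AE) simp
  ultimately show ?thesis by (metis less_le)
qed

definition cgf :: "real \<Rightarrow> real" where
  "cgf t = ln (expectation (\<lambda>\<omega>. exp (t * Y \<omega>)))"

lemma exp_cgf: "exp (cgf t) = expectation (\<lambda>\<omega>. exp (t * Y \<omega>))"
  using mgf_pos by (simp add: cgf_def)

lemma mgf_eq: "(\<integral>\<^sup>+ \<omega>. ennreal (exp (t * Y \<omega>)) \<partial>P) = ennreal (exp (cgf t))"
  unfolding exp_cgf using exp_integrable by (intro nn_integral_eq_integral) auto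

lemma log_mgf_eq: "log_mgf P Y t = ereal (cgf t)"
  by (simp add: log_mgf_def mgf_eq log_ennreal_exp)

lemma cgf_zero: "cgf 0 = 0"
  by (simp add: cgf_def prob_space)

text \<open>
  Divide by \<open>exp c\<close>, where \<open>c\<close> is the chord value, and integrate the pointwise convexity of \<open>exp\<close>
  between the normalized exponents \<open>s * Y \<omega> - cgf s\<close> and \<open>t * Y \<omega> - cgf t\<close>, whose
  exponentials have expectation one.  The result is a case of Hoelder's inequality.
\<close>

lemma cgf_convex: "convex_on UNIV cgf"
proof (rule convex_onI)
  fix l s t :: real assume l: "0 < l" "l < 1"
  define c where "c = (1 - l) * cgf s + l * cgf t"
  have split: "exp (cgf ((1 - l) *\<^sub>R s + l *\<^sub>R t)) * exp (- c)
      = expectation (\<lambda>\<omega>. exp (((1 - l) * s + l * t) * Y \<omega>) * exp (- c))"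
    by (simp add: exp_cgf)
  also have "\<dots> \<le> expectation (\<lambda>\<omega>. (1 - l) * (exp (s * Y \<omega>) * exp (- cgf s)) + l * (exp (t * Y \<omega>) * exp (- cgf t)))"
  proof (rule integral_mono)
    fix \<omega>
    have "exp ((1 - l) *\<^sub>R (s * Y \<omega> - cgf s) + l *\<^sub>R (t * Y \<omega> - cgf t))
      \<le> (1 - l) * exp (s * Y \<omega> - cgf s) + l * exp (t * Y \<omega> - cgf t)"
      using l by (intro convex_onD[OF exp_convex]) auto
    moreover have "(1 - l) *\<^sub>R (s * Y \<omega> - cgf s) + l *\<^sub>R (t * Y \<omega> - cgf t) = ((1 - l) * s + l * t) * Y \<omega> + - c"
      by (simp add: c_def algebra_simps)
    ultimately show "exp (((1 - l) * s + l * t) * Y \<omega>) * exp (- c)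
      \<le> (1 - l) * (exp (s * Y \<omega>) * exp (- cgf s)) + l * (exp (t * Y \<omega>) * exp (- cgf t))"
      by (simp only: exp_add[symmetric]) simp
  qed (auto intro!: exp_integrable)
  also have "\<dots> = (1 - l) * (exp (cgf s) * exp (- cgf s)) + l * (exp (cgf t) * exp (- cgf t))"
    unfolding exp_cgf by (subst Bochner_Integration.integral_add) (auto intro!: exp_integrable)
  also have "\<dots> = 1" by (simp flip: exp_add)
  finally have "exp (cgf ((1 - l) *\<^sub>R s + l *\<^sub>R t) - c) \<le> exp 0" by (simp flip: exp_add)
  then show "cgf ((1 - l) *\<^sub>R s + l *\<^sub>R t) \<le> (1 - l) * cgf s + l * cgf t"
    by (simp add: c_def)
qed simp

lemma cgf_deriv:
  "(cgf has_real_derivative expectation (\<lambda>\<omega>. Y \<omega> * exp (t * Y \<omega>)) / expectation (\<lambda>\<omega>. exp (t * Y \<omega>))) (at t)"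
proof -
  have "((\<lambda>t. expectation (\<lambda>\<omega>. exp (t * Y \<omega>))) has_real_derivative expectation (\<lambda>\<omega>. Y \<omega> * exp (t * Y \<omega>))) (at t)"
  proof (rule convex_family_integral_derivative)
    show "convex_on UNIV (\<lambda>t. exp (t * Y \<omega>))" for \<omega>
      by (rule convex_on_scaled_argument[OF exp_convex])
  qed (auto intro!: derivative_eq_intros exp_integrable)
  from DERIV_chain2[OF DERIV_ln_divide[OF mgf_pos] this] show ?thesis by (simp add: cgf_def[abs_def])
qed

lemma cgf_continuous: "continuous_on UNIV cgf"
  using cgf_convex by (intro convex_on_continuous) auto

lemma cgf_measurable [measurable]: "cgf \<in> borel_measurable borel"
  using cgf_continuous by (rule borel_measurable_continuous_onI)

lemma cgf_fourth_moment: "integrable std_gaussian (\<lambda>u. cgf (t * u) ^ 4)"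
proof (rule integrableI_nonneg)
  show "(\<lambda>u. cgf (t * u) ^ 4) \<in> borel_measurable std_gaussian" by measurable
  show "(\<integral>\<^sup>+ u. ennreal (cgf (t * u) ^ 4) \<partial>std_gaussian) < \<infinity>"
    using moment[of t] by (simp add: log_mgf_eq)
qed simp

lemma cgf_gaussian_integrable: "integrable std_gaussian (\<lambda>u. cgf (t * u))"
  using std_gaussian.integrable_power_le_4[OF _ cgf_fourth_moment, of t 1] by simp

abbreviation \<Psi> :: "real \<Rightarrow> real" where
  "\<Psi> \<equiv> gaussian_average (log_mgf P Y)"

lemma \<Psi>_eq: "\<Psi> t = (\<integral>u. cgf (t * u) \<partial>std_gaussian)"
  by (subst integral_std_gaussian)
     (auto simp: gaussian_average_def log_mgf_eq std_normal_density_def ac_simps)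

lemma \<Psi>_zero: "\<Psi> 0 = 0"
  by (simp add: \<Psi>_eq cgf_zero)

lemma \<Psi>_convex: "convex_on UNIV \<Psi>"
proof (rule convex_onI)
  fix l s t :: real assume l: "0 < l" "l < 1"
  have "\<Psi> ((1 - l) *\<^sub>R s + l *\<^sub>R t) \<le> (\<integral>u. (1 - l) * cgf (s * u) + l * cgf (t * u) \<partial>std_gaussian)"
    unfolding \<Psi>_eq using l
    by (intro integral_mono cgf_gaussian_integrable Bochner_Integration.integrable_add integrable_mult_right
        convex_onD[OF convex_on_scaled_argument[OF cgf_convex]]) auto
  also have "\<dots> = (1 - l) * \<Psi> s + l * \<Psi> t"
    using cgf_gaussian_integrable by (simp add: \<Psi>_eq)
  finally show "\<Psi> ((1 - l) *\<^sub>R s + l *\<^sub>R t) \<le> (1 - l) * \<Psi> s + l * \<Psi> t" .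
qed simp

lemma \<Psi>_differentiable: "\<exists>D. (\<Psi> has_real_derivative D) (at t)"
proof -
  have eq: "\<Psi> = (\<lambda>t. \<integral>u. cgf (t * u) \<partial>std_gaussian)" by (simp add: fun_eq_iff \<Psi>_eq)
  define D where "D t = expectation (\<lambda>\<omega>. Y \<omega> * exp (t * Y \<omega>)) / expectation (\<lambda>\<omega>. exp (t * Y \<omega>))" for t
  have D: "(cgf has_real_derivative D t) (at t)" for t
    unfolding D_def by (rule cgf_deriv)
  have "((\<lambda>t. \<integral>u. cgf (t * u) \<partial>std_gaussian) has_real_derivative (\<integral>u. D (t * u) * u \<partial>std_gaussian)) (at t)"
  proof (rule convex_family_integral_derivative)
    show "convex_on UNIV (\<lambda>t. cgf (t * u))" for u by (rule convex_on_scaled_argument[OF cgf_convex])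
    show "((\<lambda>t. cgf (t * u)) has_real_derivative D (t * u) * u) (at t)" for t u
      by (rule DERIV_chain2[OF D]) (auto intro!: derivative_eq_intros)
    show "integrable std_gaussian (\<lambda>u. cgf (t * u))" for t by (rule cgf_gaussian_integrable)
  qed
  then show ?thesis unfolding eq by blast
qed

sublocale gaussian_convex_average cgf \<Psi>
proof
  show "isCont \<Psi> t" for t using \<Psi>_differentiable DERIV_isCont by blast
qed (auto simp: cgf_convex cgf_fourth_moment \<Psi>_eq)

end

text \<open>
  By independence the moment generating function is a product, and \<open>n / sqrt n = sqrt n\<close>.
\<close>

lemma weighted_sum_mgf:
  assumes P: "prob_space P" and ind: "prob_space.indep_vars P (\<lambda>_. borel) X {1..}"
    and id: "\<And>i. i \<ge> 1 \<Longrightarrow> distr P borel (X i) = \<gamma>"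
    and L: "\<And>t. (\<integral>\<^sup>+ \<omega>. ennreal (exp (t * X 1 \<omega>)) \<partial>P) = ennreal (exp (L t))"
    and n: "n \<ge> 1"
  shows "(\<integral>\<^sup>+ x. ennreal (exp (real n * t * x)) \<partial>distr P borel (weighted_sum X \<theta> n))
    = ennreal (exp (real n * (1 / real n * (\<Sum>i=1..n. L (t * (sqrt (real n) * \<theta> n i))))))"
proof -
  interpret prob_space P by (rule P)
  have X: "X i \<in> borel_measurable P" if "i \<ge> 1" for i
    using ind that by (auto simp: indep_vars_def2)
  have W: "weighted_sum X \<theta> n \<in> borel_measurable P"
    unfolding weighted_sum_def using X
    by (intro borel_measurable_times borel_measurable_const borel_measurable_sum) auto
  have mgf: "(\<integral>\<^sup>+ \<omega>. ennreal (exp (s * X i \<omega>)) \<partial>P) = ennreal (exp (L s))" if "i \<ge> 1" for i s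
  proof -
    have "(\<integral>\<^sup>+ \<omega>. ennreal (exp (s * X i \<omega>)) \<partial>P) = (\<integral>\<^sup>+ x. ennreal (exp (s * x)) \<partial>\<gamma>)" if "i \<ge> 1" for i
      using that by (subst id[symmetric, OF that], subst nn_integral_distr) (auto intro: X)
    from this[OF that] this[OF order_refl] L[of s] show ?thesis by metis
  qed
  define c where "c i = t * (sqrt (real n) * \<theta> n i)" for i
  have exponent: "real n * t * weighted_sum X \<theta> n \<omega> = (\<Sum>i=1..n. c i * X i \<omega>)" for \<omega>
  proof -
    have "real n * t * weighted_sum X \<theta> n \<omega> = t * (real n / sqrt (real n)) * (\<Sum>i=1..n. X i \<omega> * \<theta> n i)"
      by (simp add: weighted_sum_def)
    also have "real n / sqrt (real n) = sqrt (real n)" by (simp add: real_div_sqrt)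
    finally show ?thesis by (simp add: c_def sum_distrib_left ac_simps)
  qed
  have "(\<integral>\<^sup>+ x. ennreal (exp (real n * t * x)) \<partial>distr P borel (weighted_sum X \<theta> n))
      = (\<integral>\<^sup>+ \<omega>. ennreal (exp (\<Sum>i=1..n. c i * X i \<omega>)) \<partial>P)"
    by (subst nn_integral_distr[OF W]) (auto simp: exponent)
  also have "\<dots> = (\<integral>\<^sup>+ \<omega>. (\<Prod>i=1..n. ennreal (exp (c i * X i \<omega>))) \<partial>P)"
    by (simp add: exp_sum prod_ennreal)
  also have "\<dots> = (\<Prod>i=1..n. \<integral>\<^sup>+ \<omega>. ennreal (exp (c i * X i \<omega>)) \<partial>P)"
    by (intro indep_vars_nn_integral indep_vars_compose2[OF indep_vars_subset[OF ind]]) auto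
  also have "\<dots> = (\<Prod>i=1..n. ennreal (exp (L (c i))))"
    using mgf by (intro prod.cong refl) auto
  also have "\<dots> = ennreal (exp (\<Sum>i=1..n. L (c i)))"
    by (simp add: exp_sum prod_ennreal)
  finally show ?thesis using n by (simp add: c_def)
qed

section \<open>The large deviation principle for random projections\<close>

theorem theorem2p4:
  fixes \<gamma> :: "real measure"
    and P :: "'a measure"
    and X :: "nat \<Rightarrow> 'a \<Rightarrow> real"
    and \<sigma> :: "(nat \<Rightarrow> nat \<Rightarrow> real) measure"
  assumes "prob_space \<gamma>" and "sets \<gamma> = sets borel"
    and "prob_space P"
    and "prob_space.indep_vars P (\<lambda>_. borel) X {1..}"
    and "\<And>i. i \<ge> 1 \<Longrightarrow> distr P borel (X i) = \<gamma>"
    and "\<And>t. (\<integral>\<^sup>+ u. e2ennreal (\<bar>log_mgf P (X 1) (t * u)\<bar> ^ 4) \<partial>std_gaussian) < \<infinity>"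
    and "prob_space \<sigma>" and "sets \<sigma> = sets sphere_sequences"
    and "\<And>n. n \<ge> 1 \<Longrightarrow> rotation_invariant_prob n (distr \<sigma> (sphere_borel n) (\<lambda>\<theta>. \<theta> n))"
  defines "I \<equiv> legendre_transform (gaussian_average (log_mgf P (X 1)))"
  shows "good_rate_function I \<and> convex_ereal I \<and>
    (AE \<theta> in \<sigma>. satisfies_LDP (\<lambda>n. distr P borel (weighted_sum X \<theta> n)) I)"
proof -
  interpret P: prob_space P by fact
  have X: "X i \<in> borel_measurable P" if "i \<ge> 1" for i
    using assms(4) that by (auto simp: P.indep_vars_def2)
  interpret cgf: gaussian_integrable_cgf P "X 1"
    by unfold_locales (use X assms(6) in auto)
  obtain D where D: "\<And>t. (cgf.\<Psi> has_real_derivative D t) (at t)"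
    using cgf.\<Psi>_differentiable by metis
  have "AE \<theta> in \<sigma>. \<forall>t. (\<lambda>n. 1 / real n * (\<Sum>i=1..n. cgf.cgf (t * (sqrt (real n) * \<theta> n i))))
      \<longlonglongrightarrow> cgf.\<Psi> t"
    by (rule cgf.AE_sphere_average_tendsto_all[OF assms(7,8)]) (rule assms(9))
  then have "AE \<theta> in \<sigma>. satisfies_LDP (\<lambda>n. distr P borel (weighted_sum X \<theta> n)) I"
  proof eventually_elim
    case (elim \<theta>)
    have W: "weighted_sum X \<theta> n \<in> borel_measurable P" for n
      unfolding weighted_sum_def using X
      by (intro borel_measurable_times borel_measurable_const borel_measurable_sum) auto
    interpret scaled_cgf_limit "\<lambda>n. distr P borel (weighted_sum X \<theta> n)"
      "\<lambda>n t. 1 / real n * (\<Sum>i=1..n. cgf.cgf (t * (sqrt (real n) * \<theta> n i)))" cgf.\<Psi> D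
    proof (rule scaled_cgf_limit.intro)
      show "prob_space (distr P borel (weighted_sum X \<theta> n))" for n
        by (rule P.prob_space_distr[OF W])
      show "(\<integral>\<^sup>+ x. ennreal (exp (real n * t * x)) \<partial>distr P borel (weighted_sum X \<theta> n))
        = ennreal (exp (real n * (1 / real n * (\<Sum>i=1..n. cgf.cgf (t * (sqrt (real n) * \<theta> n i))))))"
        if "n \<ge> 1" for n t
        using assms(3-5) cgf.mgf_eq that by (rule weighted_sum_mgf)
    qed (use elim D cgf.\<Psi>_convex cgf.\<Psi>_zero in auto)
    show ?case unfolding I_def by (rule gaertner_ellis)
  qed
  then show ?thesis
    using legendre_good_rate_function[of cgf.\<Psi>] legendre_convex[of cgf.\<Psi>] cgf.\<Psi>_zero
    by (simp add: I_def)
qed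

end
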